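(* Let $\Phi$ be an irreducible root system of rank $n$ with Weyl group $W$ and simple roots $\alpha_1,\dots,\alpha_n$. Let $c_1,\dots,c_n$ be nonnegative integers with $c_1+\cdots+c_n=n$, and let $\mathbf{i}=(i_1,\dots,i_n)\in\{1,\dots,n\}^n$ be any sequence such that $u_{i_1}\cdots u_{i_n}=u_1^{c_1}\cdots u_n^{c_n}$ (as monomials in the variables $u_1,\dots,u_n$). Then the mixed $\Phi$-Eulerian number is $$A^\Phi_{c_1,\dots,c_n}=\frac{2^n\cdot|W|}{\prod_{i=1}^n(\alpha_i,\alpha_i)}\sum_{(T,v)}\prod_{j=1}^n\left(\omega_{i_{v(j)}}^{\mathrm{desc}(j,T)},\,\omega_j^{\mathrm{desc}(j,T)}\right),$$ where the sum is over $\mathbf{i}$-compatible increasing $\Phi$-trees $(T,v)$.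
   Context: $\Phi$ is a (reduced, crystallographic) irreducible root system with weight space $\Lambda_{\mathbb{R}}$, Weyl group $W$, and $W$-invariant inner product $(\cdot,\cdot)$. The fundamental weights $\omega_1,\dots,\omega_n$ form the basis dual to the simple coroots $\alpha_i^\vee=2\alpha_i/(\alpha_i,\alpha_i)$. For $x\in\Lambda_{\mathbb{R}}$, $P_W(x)=\mathrm{ConvexHull}(w(x)\mid w\in W)$. $\mathrm{Vol}$ is normalized so that the parallelepiped generated by the simple roots has volume $1$. For $u_1,\dots,u_n\ge0$, $V_\Phi(u_1,\dots,u_n)=\mathrm{Vol}\,P_W(u_1\omega_1+\cdots+u_n\omega_n)$ is a homogeneous polynomial of degree $n$ in $u_1,\dots,u_n$. The mixed $\Phi$-Eulerian numbers $A^\Phi_{c_1,\dots,c_n}$, for $c_1,\dots,c_n\ge0$ with $c_1+\cdots+c_n=n$, are defined by $V_\Phi(u_1,\dots,u_n)=\sum_{c_1,\dots,c_n}A^\Phi_{c_1,\dots,c_n}\frac{u_1^{c_1}}{c_1!}\cdots\frac{u_n^{c_n}}{c_n!}$. Let $\Gamma$ be the Dynkin diagram of $\Phi$, regarded as a simple graph on the vertex set $[n]=\{1,\dots,n\}$ (edge multiplicities ignored): $i$ and $j$ are adjacent when $i\ne j$ and $(\alpha_i,\alpha_j)\neq0$. For a rooted tree $T$ on $[n]$ and a node $j$, $\mathrm{desc}(j,T)$ is the set of all descendants of $j$ in $T$, including $j$ itself (nodes $i$ such that $j$ lies on the path from $i$ to the root). A $\Phi$-tree is a rooted tree $T$ on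 the vertex set $[n]$ such that: (T1) for every node $i$, with $I=\mathrm{desc}(i,T)$, the induced graph $\Gamma|_I$ is connected; (T2) there are no two nodes $i\ne j$ such that $I=\mathrm{desc}(i,T)$ and $J=\mathrm{desc}(j,T)$ are disjoint and the induced graph $\Gamma|_{I\cup J}$ is connected. An increasing $\Phi$-tree $(T,v)$ is a $\Phi$-tree $T$ together with a permutation $v\in S_n$ such that $v(i)\ge v(j)$ whenever $i\in\mathrm{desc}(j,T)$. It is $\mathbf{i}$-compatible if $i_{v(j)}\in\mathrm{desc}(j,T)$ for $j=1,\dots,n$. For $I\subseteq[n]$, $\Phi_I$ is the root system with simple roots $\{\alpha_i\mid i\in I\}$, and $\omega_i^I$, $i\in I$, are its fundamental weights, i.e. the basis of $\mathrm{span}(\alpha_i\mid i\in I)$ dual to $\{\alpha_i^\vee\mid i\in I\}$ with respect to $(\cdot,\cdot)$. *)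

theory Defs
  imports "HOL-Analysis.Analysis" "HOL-Combinatorics.Permutations"
begin

section \<open>Root systems\<close>

text \<open>The weight space is the whole type \<open>'a\<close>; the \<open>W\<close>-invariant inner product is the inner
  product of the type, for which the reflections are orthogonal.\<close>

definition coroot :: "'a::euclidean_space \<Rightarrow> 'a" where
  "coroot a = (2 / (a \<bullet> a)) *\<^sub>R a"

definition refl_root :: "'a::euclidean_space \<Rightarrow> 'a \<Rightarrow> 'a" where
  "refl_root a x = x - (x \<bullet> coroot a) *\<^sub>R a"

definition root_system :: "'a::euclidean_space set \<Rightarrow> bool" where
  "root_system \<Phi> \<longleftrightarrow>
     finite \<Phi> \<and> 0 \<notin> \<Phi> \<and> span \<Phi> = UNIV \<and>
     (\<forall>a\<in>\<Phi>. \<forall>b\<in>\<Phi>. refl_root a b \<in> \<Phi>) \<and>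
     (\<forall>a\<in>\<Phi>. \<forall>b\<in>\<Phi>. b \<bullet> coroot a \<in> \<int>) \<and>
     (\<forall>a\<in>\<Phi>. \<forall>t::real. t *\<^sub>R a \<in> \<Phi> \<longrightarrow> t = 1 \<or> t = -1)"

definition irreducible_root_system :: "'a::euclidean_space set \<Rightarrow> bool" where
  "irreducible_root_system \<Phi> \<longleftrightarrow>
     root_system \<Phi> \<and> \<Phi> \<noteq> {} \<and>
     \<not> (\<exists>A B. A \<noteq> {} \<and> B \<noteq> {} \<and> A \<union> B = \<Phi> \<and> A \<inter> B = {} \<and>
            (\<forall>a\<in>A. \<forall>b\<in>B. a \<bullet> b = 0))"

text \<open>A choice of simple roots \<open>\<alpha> 1, \<dots>, \<alpha> n\<close>. If \<open>\<Phi>\<close> is a root system then \<open>n\<close> is its rank.\<close>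

definition simple_roots :: "'a::euclidean_space set \<Rightarrow> nat \<Rightarrow> (nat \<Rightarrow> 'a) \<Rightarrow> bool" where
  "simple_roots \<Phi> n \<alpha> \<longleftrightarrow>
     inj_on \<alpha> {1..n} \<and> \<alpha> ` {1..n} \<subseteq> \<Phi> \<and> independent (\<alpha> ` {1..n}) \<and>
     (\<forall>b\<in>\<Phi>. \<exists>k :: nat \<Rightarrow> nat.
        b = (\<Sum>i=1..n. real (k i) *\<^sub>R \<alpha> i) \<or> b = - (\<Sum>i=1..n. real (k i) *\<^sub>R \<alpha> i))"

inductive_set weyl_group :: "'a::euclidean_space set \<Rightarrow> ('a \<Rightarrow> 'a) set" for \<Phi> where
  weyl_id: "id \<in> weyl_group \<Phi>"
| weyl_refl: "a \<in> \<Phi> \<Longrightarrow> w \<in> weyl_group \<Phi> \<Longrightarrow> refl_root a \<circ> w \<in> weyl_group \<Phi>"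

text \<open>\<open>fund_weight \<alpha> I i\<close> is the fundamental weight \<open>\<omega>\<^sub>i\<^sup>I\<close> of the root system with simple
  roots \<open>\<alpha> j\<close>, \<open>j \<in> I\<close>. It is meaningful for \<open>i \<in> I\<close>.\<close>

definition fund_weight :: "(nat \<Rightarrow> 'a::euclidean_space) \<Rightarrow> nat set \<Rightarrow> nat \<Rightarrow> 'a" where
  "fund_weight \<alpha> I i =
     (THE x. x \<in> span (\<alpha> ` I) \<and> (\<forall>j\<in>I. x \<bullet> coroot (\<alpha> j) = (if j = i then 1 else 0)))"

section \<open>Mixed Eulerian numbers\<close>

definition weight_polytope :: "'a::euclidean_space set \<Rightarrow> 'a \<Rightarrow> 'a set" where
  "weight_polytope \<Phi> x = convex hull ((\<lambda>w. w x) ` weyl_group \<Phi>)"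

definition parallelepiped :: "nat \<Rightarrow> (nat \<Rightarrow> 'a::euclidean_space) \<Rightarrow> 'a set" where
  "parallelepiped n \<alpha> = {\<Sum>i=1..n. t i *\<^sub>R \<alpha> i | t :: nat \<Rightarrow> real. \<forall>i\<in>{1..n}. 0 \<le> t i \<and> t i \<le> 1}"

definition normalized_vol :: "nat \<Rightarrow> (nat \<Rightarrow> 'a::euclidean_space) \<Rightarrow> 'a set \<Rightarrow> real" where
  "normalized_vol n \<alpha> S = measure lborel S / measure lborel (parallelepiped n \<alpha>)"

definition vol_fun ::
    "'a::euclidean_space set \<Rightarrow> nat \<Rightarrow> (nat \<Rightarrow> 'a) \<Rightarrow> (nat \<Rightarrow> real) \<Rightarrow> real" where
  "vol_fun \<Phi> n \<alpha> u =
     normalized_vol n \<alpha> (weight_polytope \<Phi> (\<Sum>i=1..n. u i *\<^sub>R fund_weight \<alpha> {1..n} i))"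

text \<open>Sequences \<open>c\<^sub>1, \<dots>, c\<^sub>n\<close> of nonnegative integers with sum \<open>n\<close>, represented as functions
  that vanish off \<open>{1..n}\<close>.\<close>

definition exponents :: "nat \<Rightarrow> (nat \<Rightarrow> nat) set" where
  "exponents n = {c. (\<forall>i. i \<notin> {1..n} \<longrightarrow> c i = 0) \<and> (\<Sum>i=1..n. c i) = n}"

text \<open>The coefficients \<open>A c\<close> of the homogeneous polynomial \<open>vol_fun\<close>. They are unique because
  a polynomial is determined by its values on the nonnegative orthant; the condition off
  \<open>exponents n\<close> only makes the whole function \<open>A\<close> unique.\<close>

definition mixed_eulerian ::
    "'a::euclidean_space set \<Rightarrow> nat \<Rightarrow> (nat \<Rightarrow> 'a) \<Rightarrow> (nat \<Rightarrow> nat) \<Rightarrow> real" where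
  "mixed_eulerian \<Phi> n \<alpha> =
     (THE A. (\<forall>c. c \<notin> exponents n \<longrightarrow> A c = 0) \<and>
        (\<forall>u :: nat \<Rightarrow> real. (\<forall>i\<in>{1..n}. 0 \<le> u i) \<longrightarrow>
           vol_fun \<Phi> n \<alpha> u = (\<Sum>c\<in>exponents n. A c * (\<Prod>i=1..n. u i ^ c i / fact (c i)))))"

section \<open>Increasing trees\<close>

text \<open>A rooted tree on \<open>V\<close> is represented by its set \<open>T\<close> of edges, each oriented from the child to
  the parent: the root is the only node without a parent, and following parents leads to it from
  every node, which also excludes cycles.\<close>

definition rooted_tree :: "nat set \<Rightarrow> (nat \<times> nat) set \<Rightarrow> bool" where
  "rooted_tree V T \<longleftrightarrow>
     T \<subseteq> V \<times> V \<and>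
     (\<exists>r\<in>V. (\<forall>p. (r, p) \<notin> T) \<and> (\<forall>i\<in>V - {r}. \<exists>!p. (i, p) \<in> T) \<and> (\<forall>i\<in>V. (i, r) \<in> T\<^sup>*))"

definition desc :: "nat \<Rightarrow> (nat \<times> nat) set \<Rightarrow> nat set" where
  "desc j T = {i. (i, j) \<in> T\<^sup>*}"

definition dynkin_edges :: "(nat \<Rightarrow> 'a::euclidean_space) \<Rightarrow> nat \<Rightarrow> (nat \<times> nat) set" where
  "dynkin_edges \<alpha> n = {(i, j). i \<in> {1..n} \<and> j \<in> {1..n} \<and> i \<noteq> j \<and> \<alpha> i \<bullet> \<alpha> j \<noteq> 0}"

text \<open>Only applied to nonempty \<open>I\<close>.\<close>

definition induced_connected :: "(nat \<times> nat) set \<Rightarrow> nat set \<Rightarrow> bool" where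
  "induced_connected E I \<longleftrightarrow> (\<forall>i\<in>I. \<forall>j\<in>I. (i, j) \<in> (E \<inter> I \<times> I)\<^sup>*)"

definition Phi_tree :: "(nat \<Rightarrow> 'a::euclidean_space) \<Rightarrow> nat \<Rightarrow> (nat \<times> nat) set \<Rightarrow> bool" where
  "Phi_tree \<alpha> n T \<longleftrightarrow>
     rooted_tree {1..n} T \<and>
     (\<forall>i\<in>{1..n}. induced_connected (dynkin_edges \<alpha> n) (desc i T)) \<and>
     \<not> (\<exists>i\<in>{1..n}. \<exists>j\<in>{1..n}. i \<noteq> j \<and> desc i T \<inter> desc j T = {} \<and>
            induced_connected (dynkin_edges \<alpha> n) (desc i T \<union> desc j T))"

definition increasing_Phi_tree ::
    "(nat \<Rightarrow> 'a::euclidean_space) \<Rightarrow> nat \<Rightarrow> (nat \<times> nat) set \<Rightarrow> (nat \<Rightarrow> nat) \<Rightarrow> bool" where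
  "increasing_Phi_tree \<alpha> n T v \<longleftrightarrow>
     Phi_tree \<alpha> n T \<and> v permutes {1..n} \<and>
     (\<forall>i\<in>{1..n}. \<forall>j\<in>{1..n}. i \<in> desc j T \<longrightarrow> v j \<le> v i)"

definition compatible ::
    "nat \<Rightarrow> (nat \<Rightarrow> nat) \<Rightarrow> (nat \<times> nat) set \<Rightarrow> (nat \<Rightarrow> nat) \<Rightarrow> bool" where
  "compatible n ii T v \<longleftrightarrow> (\<forall>j\<in>{1..n}. ii (v j) \<in> desc j T)"

end

theory Submission
  imports Defs "HOL-Computational_Algebra.Polynomial"
    "HOL-Combinatorics.Multiset_Permutations"
begin

text \<open>
  The dominant chamber cuts the weight polytope of a dominant \<open>x\<close> into \<open>|W|\<close> congruent pieces, and
  in the coordinates of the simple roots such a piece is given by the inequalities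
  \<open>y \<bullet> \<alpha>\<^sub>i \<ge> 0\<close> and \<open>y\<^sub>i \<le> x\<^sub>i\<close>. It is a union of cones with apex \<open>0\<close> over the facets
  \<open>y\<^sub>j = x\<^sub>j\<close>, and each facet is a translate of the piece that belongs to the projection of \<open>x\<close> to
  the span of the simple roots other than \<open>\<alpha>\<^sub>j\<close>. Hence the volume is a sum over all orders in
  which the simple roots can be removed. Polarizing it needs no derivatives: the sum, with its
  linear forms in \<open>x\<close> replaced by their values at given fundamental weights, is already symmetric
  in these weights, because exchanging two of them can be undone by exchanging the two
  corresponding removals. Finally, an order of removal is a permutation \<open>v\<close>, and \<open>v\<close> belongs to
  exactly one increasing \<open>\<Phi>\<close>-tree: the descendants of \<open>j\<close> are the connected component of \<open>j\<close> in
  the diagram of the nodes \<open>l\<close> with \<open>v l \<ge> v j\<close>.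
\<close>

section \<open>Dual bases\<close>

locale indexed_basis =
  fixes \<alpha> :: "nat \<Rightarrow> 'a::euclidean_space" and N :: "nat set"
  assumes finite_N: "finite N"
    and inj: "inj_on \<alpha> N"
    and indep: "independent (\<alpha> ` N)"
begin

lemma finite_sub: "K \<subseteq> N \<Longrightarrow> finite K"
  using finite_N finite_subset by blast

definition dual :: "nat set \<Rightarrow> nat \<Rightarrow> 'a" where
  "dual K i = (THE z. z \<in> span (\<alpha> ` K) \<and> (\<forall>j\<in>K. z \<bullet> \<alpha> j = (if j = i then 1 else 0)))"

lemma span_orthogonal_zero:
  assumes "z \<in> span (\<alpha> ` K)" "\<And>j. j \<in> K \<Longrightarrow> z \<bullet> \<alpha> j = 0"
  shows "z = 0"
proof -
  have "orthogonal z y" if "y \<in> span (\<alpha> ` K)" for y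
    by (rule orthogonal_to_span[OF that]) (auto simp: orthogonal_def assms(2))
  from this[OF assms(1)] show ?thesis by (simp add: orthogonal_def)
qed

lemma span_unique:
  assumes "y \<in> span (\<alpha> ` K)" "z \<in> span (\<alpha> ` K)" "\<And>j. j \<in> K \<Longrightarrow> y \<bullet> \<alpha> j = z \<bullet> \<alpha> j"
  shows "y = z"
  using span_orthogonal_zero[of "y - z" K] assms by (auto simp: span_diff inner_diff_left)

lemma dual_ex:
  assumes "K \<subseteq> N" "i \<in> K"
  shows "\<exists>z. z \<in> span (\<alpha> ` K) \<and> (\<forall>j\<in>K. z \<bullet> \<alpha> j = (if j = i then 1 else 0))"
proof -
  obtain y z where yz: "y \<in> span (\<alpha> ` (K - {i}))"
    "\<And>w. w \<in> span (\<alpha> ` (K - {i})) \<Longrightarrow> orthogonal z w" "\<alpha> i = y + z"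
    by (rule orthogonal_subspace_decomp_exists[of "\<alpha> ` (K - {i})" "\<alpha> i"]) auto
  have "\<alpha> ` (K - {i}) = \<alpha> ` K - {\<alpha> i}"
    using assms inj by (auto simp: inj_on_def)
  moreover have "independent (\<alpha> ` K)"
    using indep assms(1) by (meson image_mono independent_mono)
  ultimately have "\<alpha> i \<notin> span (\<alpha> ` (K - {i}))"
    using assms(2) by (auto simp: dependent_def)
  then have "z \<noteq> 0" using yz by auto
  have zi: "z \<bullet> \<alpha> i = z \<bullet> z"
    using yz(2)[OF yz(1)] by (simp add: yz(3) inner_add_right orthogonal_def)
  have zj: "z \<bullet> \<alpha> j = 0" if "j \<in> K" "j \<noteq> i" for j
    using yz(2)[of "\<alpha> j"] that by (auto simp: orthogonal_def span_base)
  have "y \<in> span (\<alpha> ` K)" using yz(1) span_mono[of "\<alpha> ` (K - {i})" "\<alpha> ` K"] by auto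
  then have "z \<in> span (\<alpha> ` K)"
    using yz(3) assms(2) by (metis add_diff_cancel_left' imageI span_base span_diff)
  then show ?thesis
    using zi zj \<open>z \<noteq> 0\<close> by (intro exI[of _ "(1 / (z \<bullet> z)) *\<^sub>R z"]) (auto simp: span_scale)
qed

lemma dual_props:
  assumes "K \<subseteq> N" "i \<in> K"
  shows "dual K i \<in> span (\<alpha> ` K) \<and> (\<forall>j\<in>K. dual K i \<bullet> \<alpha> j = (if j = i then 1 else 0))"
proof -
  have "\<exists>!z. z \<in> span (\<alpha> ` K) \<and> (\<forall>j\<in>K. z \<bullet> \<alpha> j = (if j = i then 1 else 0))"
  proof (rule ex_ex1I[OF dual_ex[OF assms]])
    fix y z
    assume "y \<in> span (\<alpha> ` K) \<and> (\<forall>j\<in>K. y \<bullet> \<alpha> j = (if j = i then 1 else 0))"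
      and "z \<in> span (\<alpha> ` K) \<and> (\<forall>j\<in>K. z \<bullet> \<alpha> j = (if j = i then 1 else 0))"
    then show "y = z" by (intro span_unique[of y K z]) auto
  qed
  then show ?thesis unfolding dual_def by (rule theI')
qed

lemma dual_span: "K \<subseteq> N \<Longrightarrow> i \<in> K \<Longrightarrow> dual K i \<in> span (\<alpha> ` K)"
  using dual_props by blast

lemma dual_inner: "K \<subseteq> N \<Longrightarrow> i \<in> K \<Longrightarrow> j \<in> K \<Longrightarrow> dual K i \<bullet> \<alpha> j = (if j = i then 1 else 0)"
  using dual_props by blast

lemma simple_inner_dual: "K \<subseteq> N \<Longrightarrow> i \<in> K \<Longrightarrow> j \<in> K \<Longrightarrow> \<alpha> j \<bullet> dual K i = (if j = i then 1 else 0)"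
  by (simp add: dual_inner inner_commute[of "\<alpha> j"])

lemma dual_eqI:
  assumes "K \<subseteq> N" "i \<in> K" "z \<in> span (\<alpha> ` K)"
    "\<And>j. j \<in> K \<Longrightarrow> z \<bullet> \<alpha> j = (if j = i then 1 else 0)"
  shows "dual K i = z"
  using dual_span dual_inner assms by (intro span_unique[of _ K]) auto

lemma simple_nonzero: "i \<in> N \<Longrightarrow> \<alpha> i \<noteq> 0"
  using indep dependent_zero[of "\<alpha> ` N"] by auto

lemma dual_nonzero: "K \<subseteq> N \<Longrightarrow> i \<in> K \<Longrightarrow> dual K i \<noteq> 0"
  using dual_inner[of K i i] by auto

lemma fund_weight_eq:
  assumes "K \<subseteq> N" "i \<in> K"
  shows "fund_weight \<alpha> K i = ((\<alpha> i \<bullet> \<alpha> i) / 2) *\<^sub>R dual K i"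
  unfolding fund_weight_def
proof (rule the_equality, intro conjI ballI)
  show "((\<alpha> i \<bullet> \<alpha> i) / 2) *\<^sub>R dual K i \<in> span (\<alpha> ` K)"
    using dual_span[OF assms] by (rule span_scale)
  show "((\<alpha> i \<bullet> \<alpha> i) / 2) *\<^sub>R dual K i \<bullet> coroot (\<alpha> j) = (if j = i then 1 else 0)" if "j \<in> K" for j
    using dual_inner[OF assms that] simple_nonzero[of i] assms by (auto simp: coroot_def)
next
  fix x assume x: "x \<in> span (\<alpha> ` K) \<and> (\<forall>j\<in>K. x \<bullet> coroot (\<alpha> j) = (if j = i then 1 else 0))"
  show "x = ((\<alpha> i \<bullet> \<alpha> i) / 2) *\<^sub>R dual K i"
  proof (rule span_unique[of _ K])
    fix j assume j: "j \<in> K"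
    have "\<alpha> j \<bullet> \<alpha> j \<noteq> 0" using simple_nonzero[of j] j assms by auto
    then have "x \<bullet> \<alpha> j = (\<alpha> j \<bullet> \<alpha> j / 2) * (x \<bullet> coroot (\<alpha> j))" by (simp add: coroot_def)
    then show "x \<bullet> \<alpha> j = ((\<alpha> i \<bullet> \<alpha> i) / 2) *\<^sub>R dual K i \<bullet> \<alpha> j"
      using x j dual_inner[OF assms j] by auto
  qed (use x dual_span[OF assms] in \<open>auto intro: span_scale\<close>)
qed

lemma inner_sum_dual:
  assumes "K \<subseteq> N" "j \<in> K"
  shows "(\<Sum>k\<in>K. t k *\<^sub>R \<alpha> k) \<bullet> dual K j = t j"
proof -
  have "(\<Sum>k\<in>K. t k *\<^sub>R \<alpha> k) \<bullet> dual K j = (\<Sum>k\<in>K. if k = j then t j else 0)"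
    unfolding inner_sum_left using dual_inner[OF assms]
    by (intro sum.cong) (auto simp: inner_commute)
  then show ?thesis using assms finite_sub by simp
qed

lemma dual_expansion:
  assumes "K \<subseteq> N" "y \<in> span (\<alpha> ` K)"
  shows "y = (\<Sum>k\<in>K. (y \<bullet> dual K k) *\<^sub>R \<alpha> k)"
proof (rule span_unique[of _ K])
  obtain c where "y = (\<Sum>v\<in>\<alpha> ` K. c v *\<^sub>R v)"
    using assms(2) finite_sub[OF assms(1)] by (auto simp: span_finite)
  also have "\<dots> = (\<Sum>k\<in>K. c (\<alpha> k) *\<^sub>R \<alpha> k)"
    using inj_on_subset[OF inj assms(1)] by (simp add: sum.reindex)
  finally have y: "y = (\<Sum>k\<in>K. c (\<alpha> k) *\<^sub>R \<alpha> k)" .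
  then have "y \<bullet> dual K k = c (\<alpha> k)" if "k \<in> K" for k
    using inner_sum_dual[OF assms(1) that, of "\<lambda>k. c (\<alpha> k)"] by simp
  then show "y \<bullet> \<alpha> j = (\<Sum>k\<in>K. (y \<bullet> dual K k) *\<^sub>R \<alpha> k) \<bullet> \<alpha> j" for j
    using y by simp
  show "(\<Sum>k\<in>K. (y \<bullet> dual K k) *\<^sub>R \<alpha> k) \<in> span (\<alpha> ` K)"
    by (intro span_sum span_scale span_base) auto
qed (rule assms(2))

lemma span_insert_simple:
  assumes "K \<subseteq> N" "j \<in> K" "z \<in> span (\<alpha> ` K)" "z \<bullet> dual K j = 0"
  shows "z \<in> span (\<alpha> ` (K - {j}))"
proof -
  have "z = (\<Sum>k\<in>K. (z \<bullet> dual K k) *\<^sub>R \<alpha> k)" by (rule dual_expansion[OF assms(1,3)])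
  also have "\<dots> = (\<Sum>k\<in>K - {j}. (z \<bullet> dual K k) *\<^sub>R \<alpha> k)"
    using assms(4) finite_sub[OF assms(1)] by (intro sum.mono_neutral_right) auto
  also have "\<dots> \<in> span (\<alpha> ` (K - {j}))"
    by (intro span_sum span_scale span_base) auto
  finally show ?thesis .
qed

lemma dual_remove:
  assumes "K \<subseteq> N" "j \<in> K" "l \<in> K" "l \<noteq> j"
  shows "dual (K - {j}) l = dual K l - ((dual K l \<bullet> dual K j) / (dual K j \<bullet> dual K j)) *\<^sub>R dual K j"
proof (rule dual_eqI)
  show "dual K l - ((dual K l \<bullet> dual K j) / (dual K j \<bullet> dual K j)) *\<^sub>R dual K j \<in> span (\<alpha> ` (K - {j}))"
    using assms dual_nonzero[of K j]
    by (intro span_insert_simple) (auto simp: dual_span span_diff span_scale inner_diff_left)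
qed (use assms in \<open>auto simp: inner_diff_left dual_inner\<close>)

end

locale obtuse_basis = indexed_basis +
  assumes obtuse: "i \<in> N \<Longrightarrow> j \<in> N \<Longrightarrow> i \<noteq> j \<Longrightarrow> \<alpha> i \<bullet> \<alpha> j \<le> 0"
begin

text \<open>Split the vector into its negative and positive parts: by obtuseness their inner product is
  nonnegative, while the negative part has nonpositive inner product with the whole.\<close>

lemma dominant_coefficients_nonneg:
  assumes K: "K \<subseteq> N" and dom: "\<And>i. i \<in> K \<Longrightarrow> 0 \<le> (\<Sum>k\<in>K. t k *\<^sub>R \<alpha> k) \<bullet> \<alpha> i" and j: "j \<in> K"
  shows "0 \<le> t j"
proof -
  let ?p = "\<Sum>k\<in>K. max (t k) 0 *\<^sub>R \<alpha> k" and ?m = "\<Sum>k\<in>K. max (- t k) 0 *\<^sub>R \<alpha> k"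
  have y: "(\<Sum>k\<in>K. t k *\<^sub>R \<alpha> k) = ?p - ?m"
    unfolding sum_subtractf[symmetric] scaleR_diff_left[symmetric] by (intro sum.cong) auto
  have "0 \<le> (?p - ?m) \<bullet> ?m"
    unfolding y[symmetric] inner_sum_right inner_scaleR_right
    by (intro sum_nonneg mult_nonneg_nonneg dom) auto
  moreover have "?p \<bullet> ?m \<le> 0"
    unfolding inner_sum_right inner_sum_left
  proof (intro sum_nonpos)
    fix a b assume ab: "a \<in> K" "b \<in> K"
    show "max (t b) 0 *\<^sub>R \<alpha> b \<bullet> max (- t a) 0 *\<^sub>R \<alpha> a \<le> 0"
    proof (cases "a = b")
      case False
      then have "\<alpha> b \<bullet> \<alpha> a \<le> 0" using obtuse ab K by blast
      then show ?thesis by (auto simp: mult_nonneg_nonpos)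
    qed (auto simp: max_def)
  qed
  ultimately have "?m \<bullet> ?m \<le> 0" by (simp add: inner_diff_left)
  then have "?m = 0" using inner_ge_zero[of ?m] inner_eq_zero_iff[of ?m] by (metis antisym)
  then have "max (- t j) 0 = 0"
    using inner_sum_dual[OF K j, of "\<lambda>k. max (- t k) 0"] by simp
  then show ?thesis by simp
qed

lemma dual_dual_nonneg:
  assumes "K \<subseteq> N" "i \<in> K" "j \<in> K"
  shows "0 \<le> dual K i \<bullet> dual K j"
proof (rule dominant_coefficients_nonneg[OF assms(1) _ assms(3)])
  fix k assume "k \<in> K"
  then show "0 \<le> (\<Sum>k\<in>K. (dual K i \<bullet> dual K k) *\<^sub>R \<alpha> k) \<bullet> \<alpha> k"
    unfolding dual_expansion[OF assms(1) dual_span[OF assms(1,2)], symmetric]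
    using dual_inner[OF assms(1,2)] by auto
qed

lemma inner_dual_nonneg:
  assumes "K \<subseteq> N" "j \<in> K" "\<And>i. i \<in> K \<Longrightarrow> 0 \<le> x \<bullet> \<alpha> i"
  shows "0 \<le> x \<bullet> dual K j"
proof -
  have "x \<bullet> dual K j = (\<Sum>k\<in>K. (dual K j \<bullet> dual K k) * (x \<bullet> \<alpha> k))"
    by (subst dual_expansion[OF assms(1) dual_span[OF assms(1,2)]]) (simp add: inner_sum_right)
  then show ?thesis
    using dual_dual_nonneg assms by (auto intro!: sum_nonneg)
qed

end

section \<open>Translation-invariant measures\<close>

lemma emeasure_UN_AE:
  assumes "finite I" "\<And>i. i \<in> I \<Longrightarrow> F i \<in> sets M"
    "\<And>i j. i \<in> I \<Longrightarrow> j \<in> I \<Longrightarrow> i \<noteq> j \<Longrightarrow> F i \<inter> F j \<in> null_sets M"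
  shows "emeasure M (\<Union>i\<in>I. F i) = (\<Sum>i\<in>I. emeasure M (F i))"
  using assms
proof (induction I rule: finite_induct)
  case (insert i I)
  have "(\<Union>j\<in>I. F i \<inter> F j) \<in> null_sets M"
    using insert by (intro null_sets_UN' countable_finite) auto
  then have "AE x in M. \<not> (x \<in> F i \<and> x \<in> (\<Union>j\<in>I. F j))"
    by (intro AE_I'[of "\<Union>j\<in>I. F i \<inter> F j"]) auto
  then have "emeasure M (F i \<union> (\<Union>j\<in>I. F j)) = emeasure M (F i) + emeasure M (\<Union>j\<in>I. F j)"
    using insert by (intro emeasure_add_AE) auto
  then show ?case using insert by auto
qed simp

text \<open>Fubini for the product of the two measures: the translations turn
  \<open>f x * g y\<close> into \<open>f y * g (y - x)\<close>.\<close>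

lemma translation_invariant_proportional:
  fixes M :: "'a::euclidean_space measure"
  assumes "sigma_finite_measure M" and sets_M [measurable_cong]: "sets M = sets borel"
    and inv: "\<And>x. distr M borel ((+) x) = M"
    and [measurable]: "A \<in> sets borel" "B \<in> sets borel" and sym: "\<And>x. - x \<in> B \<longleftrightarrow> x \<in> B"
  shows "emeasure M A * emeasure lborel B = emeasure lborel A * emeasure M B"
proof -
  interpret M: sigma_finite_measure M by fact
  interpret pair_sigma_finite M lborel ..
  have shift_M: "(\<integral>\<^sup>+x. h x \<partial>M) = (\<integral>\<^sup>+x. h (y + x) \<partial>M)"
    if [measurable]: "h \<in> borel_measurable borel" for h :: "'a \<Rightarrow> ennreal" and y
    by (subst inv[of y, symmetric], subst nn_integral_distr) auto
  have shift_L: "(\<integral>\<^sup>+x. h x \<partial>lborel) = (\<integral>\<^sup>+x. h (y + x) \<partial>lborel)"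
    if [measurable]: "h \<in> borel_measurable borel" for h :: "'a \<Rightarrow> ennreal" and y
    by (subst lborel_distr_plus[of y, symmetric], subst nn_integral_distr) auto
  let ?f = "indicator A :: 'a \<Rightarrow> ennreal" and ?g = "indicator B :: 'a \<Rightarrow> ennreal"
  have "emeasure M A * emeasure lborel B = (\<integral>\<^sup>+y. \<integral>\<^sup>+x. ?f x * ?g y \<partial>M \<partial>lborel)"
    by (simp add: nn_integral_multc nn_integral_cmult sets_M)
  also have "\<dots> = (\<integral>\<^sup>+y. \<integral>\<^sup>+x. ?f (y + x) * ?g y \<partial>M \<partial>lborel)"
    by (rule nn_integral_cong, rule shift_M) measurable
  also have "\<dots> = (\<integral>\<^sup>+x. \<integral>\<^sup>+y. ?f (y + x) * ?g y \<partial>lborel \<partial>M)"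
    by (rule Fubini') measurable
  also have "\<dots> = (\<integral>\<^sup>+x. \<integral>\<^sup>+y. ?f y * ?g (y - x) \<partial>lborel \<partial>M)"
  proof (rule nn_integral_cong)
    fix x
    show "(\<integral>\<^sup>+y. ?f (y + x) * ?g y \<partial>lborel) = (\<integral>\<^sup>+y. ?f y * ?g (y - x) \<partial>lborel)"
      by (subst (2) shift_L[of _ x]) (auto simp: add.commute)
  qed
  also have "\<dots> = (\<integral>\<^sup>+y. \<integral>\<^sup>+x. ?f y * ?g (y - x) \<partial>M \<partial>lborel)"
    by (rule Fubini'[symmetric]) measurable
  also have "\<dots> = (\<integral>\<^sup>+y. \<integral>\<^sup>+x. ?f y * ?g x \<partial>M \<partial>lborel)"
  proof (rule nn_integral_cong)
    fix y
    have "?g (y - (y + x)) = ?g x" for x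
      using sym[of x] by (auto simp: indicator_def)
    then show "(\<integral>\<^sup>+x. ?f y * ?g (y - x) \<partial>M) = (\<integral>\<^sup>+x. ?f y * ?g x \<partial>M)"
      by (subst shift_M[of _ y]) auto
  qed
  also have "\<dots> = emeasure lborel A * emeasure M B"
    by (simp add: nn_integral_multc nn_integral_cmult sets_M)
  finally show ?thesis .
qed

lemma emeasure_lborel_orthogonal_vimage:
  fixes w :: "'a::euclidean_space \<Rightarrow> 'a"
  assumes w: "orthogonal_transformation w" and A: "A \<in> sets borel"
  shows "emeasure lborel (w -` A) = emeasure lborel A"
proof -
  have lin: "linear w" using w by (simp add: orthogonal_transformation_linear)
  have [measurable]: "w \<in> borel_measurable borel"
    using lin by (simp add: borel_measurable_continuous_onI linear_continuous_on
        linear_conv_bounded_linear)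
  let ?M = "distr lborel borel w"
  have bij: "bij w" using w by (rule orthogonal_transformation_bij)
  have inv: "distr ?M borel ((+) x) = ?M" for x
  proof -
    obtain y where y: "w y = x" using bij by (metis bij_pointE)
    have "distr ?M borel ((+) x) = distr lborel borel (\<lambda>z. x + w z)"
      by (subst distr_distr) (auto simp: comp_def)
    also have "\<dots> = distr (distr lborel borel ((+) y)) borel w"
      using lin y by (subst distr_distr) (auto simp: comp_def linear_add)
    finally show ?thesis by (simp add: lborel_distr_plus)
  qed
  have vimB: "w -` cball 0 1 = cball 0 1"
    using w by (auto simp: orthogonal_transformation)
  have sf: "sigma_finite_measure ?M"
  proof (rule sigma_finite_measure.intro, intro exI conjI ballI)
    let ?C = "range (\<lambda>n::nat. cball (0::'a) (real n))"
    show "countable ?C" by simp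
    show "?C \<subseteq> sets ?M" by auto
    show "\<Union> ?C = space ?M" using real_arch_simple by (fastforce simp: dist_norm)
    fix a assume "a \<in> ?C"
    then obtain n where n: "a = cball 0 (real n)" by auto
    have "w -` a = cball 0 (real n)"
      using w by (auto simp: n orthogonal_transformation)
    then have "emeasure ?M a = emeasure lborel (cball (0::'a) (real n))"
      by (simp add: emeasure_distr n)
    also have "\<dots> < \<infinity>" by (intro emeasure_bounded_finite) auto
    finally show "emeasure ?M a \<noteq> \<infinity>" by simp
  qed
  have "emeasure ?M A * emeasure lborel (cball (0::'a) 1)
      = emeasure lborel A * emeasure ?M (cball 0 1)"
    using A by (intro translation_invariant_proportional sf inv) auto
  also have "emeasure ?M (cball 0 1) = emeasure lborel (cball (0::'a) 1)"
    by (simp add: emeasure_distr vimB)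
  finally have *: "emeasure ?M A * emeasure lborel (cball (0::'a) 1)
      = emeasure lborel A * emeasure lborel (cball (0::'a) 1)" .
  have fin: "emeasure lborel (cball (0::'a) 1) \<noteq> \<infinity>"
    using emeasure_bounded_finite[of "cball (0::'a) 1"] by auto
  have "emeasure lborel (ball (0::'a) 1) \<noteq> 0"
    using emeasure_lborel_ball_finite open_not_negligible[of "ball (0::'a) 1"]
    by (auto simp: negligible_iff_null_sets null_sets_def)
  moreover have "emeasure lborel (ball (0::'a) 1) \<le> emeasure lborel (cball (0::'a) 1)"
    by (intro emeasure_mono) auto
  ultimately have "emeasure lborel (cball (0::'a) 1) \<noteq> 0" by auto
  then have "emeasure ?M A = emeasure lborel A"
    using * fin by (auto simp: mult.commute[of _ "emeasure lborel (cball (0::'a) 1)"] ennreal_mult_cancel_left)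
  then show ?thesis using A by (simp add: emeasure_distr)
qed

abbreviation lborel_PiM :: "nat set \<Rightarrow> (nat \<Rightarrow> real) measure" where
  "lborel_PiM K \<equiv> \<Pi>\<^sub>M k\<in>K. lborel"

interpretation lborel_product: product_sigma_finite "\<lambda>_::nat. lborel :: real measure"
  by standard

lemma emeasure_lborel_affine_vimage:
  fixes A :: "real set"
  assumes [measurable]: "A \<in> sets borel" and s: "s > 0"
  shows "emeasure lborel A = ennreal s * emeasure lborel {x. s * (x + b) \<in> A}"
proof -
  have "emeasure lborel A = (\<integral>\<^sup>+x. indicator A x \<partial>lborel)" by simp
  also have "\<dots> = ennreal s * (\<integral>\<^sup>+x. indicator A (s * b + s * x) \<partial>lborel)"
    using s by (subst nn_integral_real_affine[of _ s "s * b"]) auto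
  also have "(\<integral>\<^sup>+x. indicator A (s * b + s * x) \<partial>lborel)
      = (\<integral>\<^sup>+x. indicator {x. s * (x + b) \<in> A} x \<partial>lborel)"
    by (intro nn_integral_cong) (auto simp: indicator_def algebra_simps)
  finally show ?thesis by simp
qed

lemma emeasure_PiM_affine:
  assumes K: "finite K" and A: "A \<in> sets (lborel_PiM K)" and s: "s > 0"
  shows "emeasure (lborel_PiM K) A = ennreal (s ^ card K) *
    emeasure (lborel_PiM K) {t \<in> space (lborel_PiM K). (\<lambda>k\<in>K. s * (t k + b k)) \<in> A}"
proof -
  let ?T = "\<lambda>t. \<lambda>k\<in>K. s * (t k + b k)"
  let ?P = "lborel_PiM K"
  let ?M = "scale_measure (ennreal (s ^ card K)) (distr ?P ?P ?T)"
  have [measurable]: "?T \<in> measurable ?P ?P" by measurable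
  have "?M = ?P"
  proof (rule lborel_product.PiM_eqI[OF K])
    fix B :: "nat \<Rightarrow> real set" assume B: "\<And>i. i \<in> K \<Longrightarrow> B i \<in> sets lborel"
    have [measurable]: "Pi\<^sub>E K B \<in> sets ?P" using B K by (intro sets_PiM_I_finite) auto
    have "?T -` Pi\<^sub>E K B \<inter> space ?P = (\<Pi>\<^sub>E k\<in>K. {x. s * (x + b k) \<in> B k})"
      by (auto simp: space_PiM PiE_iff)
    then have "emeasure ?M (Pi\<^sub>E K B)
        = ennreal (s ^ card K) * emeasure ?P (\<Pi>\<^sub>E k\<in>K. {x. s * (x + b k) \<in> B k})"
      by (simp add: emeasure_distr)
    also have "emeasure ?P (\<Pi>\<^sub>E k\<in>K. {x. s * (x + b k) \<in> B k})
        = (\<Prod>k\<in>K. emeasure lborel {x. s * (x + b k) \<in> B k})"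
    proof (rule lborel_product.emeasure_PiM[OF K])
      fix k assume "k \<in> K"
      then have [measurable]: "B k \<in> sets borel" using B by auto
      show "{x. s * (x + b k) \<in> B k} \<in> sets lborel" by measurable
    qed
    also have "ennreal (s ^ card K) * \<dots>
        = (\<Prod>k\<in>K. ennreal s * emeasure lborel {x. s * (x + b k) \<in> B k})"
      using s by (simp add: prod.distrib ennreal_power)
    also have "\<dots> = (\<Prod>k\<in>K. emeasure lborel (B k))"
      using B s by (intro prod.cong refl emeasure_lborel_affine_vimage[symmetric]) auto
    finally show "emeasure ?M (Pi\<^sub>E K B) = (\<Prod>k\<in>K. emeasure lborel (B k))" .
  qed simp
  then have "emeasure ?P A = emeasure ?M A" by simp
  also have "\<dots> = ennreal (s ^ card K) * emeasure ?P {t \<in> space ?P. ?T t \<in> A}"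
    using A by (simp add: emeasure_distr vimage_def Int_def conj_commute)
  finally show ?thesis .
qed

lemma null_sets_PiM_hyperplane:
  assumes K: "finite K" and i: "i \<in> K" and a: "a i \<noteq> (0::real)"
  shows "{t \<in> space (lborel_PiM K). (\<Sum>k\<in>K. a k * t k) = 0} \<in> null_sets (lborel_PiM K)"
proof -
  let ?H = "{t \<in> space (lborel_PiM K). (\<Sum>k\<in>K. a k * t k) = 0}"
  define J where "J = K - {i}"
  have J: "finite J" "i \<notin> J" "K = insert i J" using K i by (auto simp: J_def)
  have H [measurable]: "?H \<in> sets (lborel_PiM K)" by measurable
  have fin: "finite {y. x(i := y) \<in> ?H}" for x
  proof (rule finite_subset)
    have "(\<Sum>k\<in>K. a k * (x(i := y)) k) = a i * y + (\<Sum>k\<in>J. a k * x k)" for y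
      using J by (auto intro!: sum.cong)
    then show "{y. x(i := y) \<in> ?H} \<subseteq> {- (\<Sum>k\<in>J. a k * x k) / a i}"
      using a by (auto simp: field_simps add_eq_0_iff)
  qed simp
  have "emeasure (lborel_PiM K) ?H = (\<integral>\<^sup>+t. indicator ?H t \<partial>lborel_PiM (insert i J))"
    using H J(3) by simp
  also have "\<dots> = (\<integral>\<^sup>+x. \<integral>\<^sup>+y. indicator ?H (x(i := y)) \<partial>lborel \<partial>lborel_PiM J)"
    using H J by (intro lborel_product.product_nn_integral_insert) auto
  also have "\<dots> = (\<integral>\<^sup>+x. 0 \<partial>lborel_PiM J)"
  proof (intro nn_integral_cong)
    fix x assume "x \<in> space (lborel_PiM J)"
    have "(\<integral>\<^sup>+y. indicator ?H (x(i := y)) \<partial>lborel) = (\<integral>\<^sup>+y. indicator {y. x(i := y) \<in> ?H} y \<partial>lborel)"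
      by (intro nn_integral_cong) (auto simp: indicator_def)
    also have "\<dots> = emeasure lborel {y. x(i := y) \<in> ?H}"
      using fin[of x] by (intro nn_integral_indicator) (auto intro: borel_closed finite_imp_closed)
    also have "\<dots> = 0"
      using fin[of x] by (intro emeasure_lborel_countable countable_finite)
    finally show "(\<integral>\<^sup>+y. indicator ?H (x(i := y)) \<partial>lborel) = 0" .
  qed
  finally show ?thesis using H by (auto simp: null_sets_def)
qed

section \<open>Decomposition of a dominant cell into cones\<close>

context obtuse_basis
begin

definition vec :: "nat set \<Rightarrow> (nat \<Rightarrow> real) \<Rightarrow> 'a" where
  "vec K t = (\<Sum>k\<in>K. t k *\<^sub>R \<alpha> k)"

text \<open>In the coordinates of the simple roots, \<open>cell K x\<close> is the part of the weight polytope of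
  the projection of \<open>x\<close> to the span of \<open>K\<close> that lies in the dominant chamber.\<close>

definition cell :: "nat set \<Rightarrow> 'a \<Rightarrow> (nat \<Rightarrow> real) set" where
  "cell K x = {t \<in> space (lborel_PiM K). \<forall>i\<in>K. 0 \<le> vec K t \<bullet> \<alpha> i \<and> t i \<le> x \<bullet> dual K i}"

text \<open>The cone with apex \<open>0\<close> over the facet of \<open>cell K x\<close> on which the \<open>j\<close>-th upper bound is attained.\<close>

definition wedge :: "nat set \<Rightarrow> 'a \<Rightarrow> nat \<Rightarrow> (nat \<Rightarrow> real) set" where
  "wedge K x j = {t \<in> space (lborel_PiM K). (\<forall>i\<in>K. 0 \<le> vec K t \<bullet> \<alpha> i) \<and> t j \<le> x \<bullet> dual K j \<and>
     (\<forall>k\<in>K. t k * (x \<bullet> dual K j) \<le> t j * (x \<bullet> dual K k))}"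

primrec cell_vol :: "nat \<Rightarrow> nat set \<Rightarrow> 'a \<Rightarrow> real" where
  "cell_vol 0 K x = 1"
| "cell_vol (Suc m) K x = (\<Sum>j\<in>K. (x \<bullet> dual K j) * cell_vol m (K - {j}) x) / real (Suc m)"

lemma measurable_vec_inner [measurable]: "(\<lambda>t. vec K t \<bullet> y) \<in> borel_measurable (lborel_PiM K)"
  unfolding vec_def inner_sum_left inner_scaleR_left by measurable

lemma cell_sets [measurable]: "cell K x \<in> sets (lborel_PiM K)"
  unfolding cell_def by measurable

lemma wedge_sets [measurable]:
  assumes "j \<in> K"
  shows "wedge K x j \<in> sets (lborel_PiM K)"
proof -
  have "Measurable.pred (lborel_PiM K) (\<lambda>t. t j \<le> x \<bullet> dual K j)"
    "Measurable.pred (lborel_PiM K)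
      (\<lambda>t. \<forall>k\<in>K. 0 \<le> t j * (x \<bullet> dual K k) - t k * (x \<bullet> dual K j))"
    using assms by measurable
  then have [measurable]: "Measurable.pred (lborel_PiM K) (\<lambda>t. t j \<le> x \<bullet> dual K j)"
    "Measurable.pred (lborel_PiM K) (\<lambda>t. \<forall>k\<in>K. t k * (x \<bullet> dual K j) \<le> t j * (x \<bullet> dual K k))"
    by simp_all
  show ?thesis unfolding wedge_def by measurable
qed

lemma vec_dominant_nonneg:
  assumes "K \<subseteq> N" "\<And>i. i \<in> K \<Longrightarrow> 0 \<le> vec K t \<bullet> \<alpha> i" "j \<in> K"
  shows "0 \<le> t j"
  using dominant_coefficients_nonneg[of K t j] assms by (simp add: vec_def)

lemma cell_vol_nonneg:
  assumes "K \<subseteq> N" "\<And>i. i \<in> K \<Longrightarrow> 0 \<le> x \<bullet> \<alpha> i"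
  shows "0 \<le> cell_vol m K x"
  using assms
proof (induction m arbitrary: K)
  case (Suc m)
  have "0 \<le> cell_vol m (K - {j}) x" for j
    using Suc.prems by (intro Suc.IH) auto
  then show ?case
    using Suc.prems inner_dual_nonneg[OF Suc.prems(1)] by (auto intro!: sum_nonneg divide_nonneg_nonneg)
qed simp

lemma cell_null:
  assumes K: "K \<subseteq> N" and i: "i \<in> K" and le: "x \<bullet> dual K i \<le> 0"
  shows "emeasure (lborel_PiM K) (cell K x) = 0"
proof -
  have "cell K x \<subseteq> {t \<in> space (lborel_PiM K). (\<Sum>k\<in>K. (if k = i then 1 else 0) * t k) = 0}"
  proof
    fix t assume t: "t \<in> cell K x"
    then have "0 \<le> t i" by (intro vec_dominant_nonneg[OF K _ i, of t]) (auto simp: cell_def)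
    moreover have "t i \<le> 0" using t i le by (force simp: cell_def)
    ultimately have "t i = 0" by simp
    then have "(\<Sum>k\<in>K. (if k = i then 1 else 0) * t k) = 0" by (intro sum.neutral) auto
    then show "t \<in> {t \<in> space (lborel_PiM K). (\<Sum>k\<in>K. (if k = i then 1 else 0) * t k) = 0}"
      using t by (auto simp: cell_def)
  qed
  moreover have "{t \<in> space (lborel_PiM K). (\<Sum>k\<in>K. (if k = i then 1 else 0) * t k) = 0}
      \<in> null_sets (lborel_PiM K)"
    using i finite_sub[OF K] by (intro null_sets_PiM_hyperplane) auto
  ultimately have "cell K x \<in> null_sets (lborel_PiM K)"
    using null_sets_subset[OF _ cell_sets] by blast
  then show ?thesis by (rule null_setsD1)
qed

lemma wedge_slice:
  assumes K: "K \<subseteq> N" and j: "j \<in> K" and dom: "0 \<le> x \<bullet> \<alpha> j"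
    and pos: "0 < x \<bullet> dual K j" and \<tau>: "0 < \<tau>" "\<tau> \<le> x \<bullet> dual K j"
  shows "emeasure (lborel_PiM (K - {j})) {t \<in> space (lborel_PiM (K - {j})). t(j := \<tau>) \<in> wedge K x j}
    = ennreal ((\<tau> / (x \<bullet> dual K j)) ^ card (K - {j}))
        * emeasure (lborel_PiM (K - {j})) (cell (K - {j}) x)"
proof -
  define J where "J = K - {j}"
  define \<xi> where "\<xi> = (\<lambda>k. x \<bullet> dual K k)"
  define s where "s = \<tau> / \<xi> j"
  define d where "d = dual K j \<bullet> dual K j"
  define b where "b = (\<lambda>k. \<xi> j * (dual K j \<bullet> dual K k) / d)"
  have finK: "finite K" using finite_sub K by blast
  have JN: "J \<subseteq> N" and KJ: "K = insert j J" "j \<notin> J" "finite J" using K j finK by (auto simp: J_def)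
  have d: "d > 0" using dual_nonzero[OF K j] by (simp add: d_def)
  have s: "s > 0" and s\<xi>: "s * \<xi> j = \<tau>" using \<tau> pos by (auto simp: s_def \<xi>_def)
  let ?A = "{t \<in> space (lborel_PiM J). t(j := \<tau>) \<in> wedge K x j}"
  let ?T = "\<lambda>q. \<lambda>k\<in>J. s * (q k + b k)"
  have bj: "b j = \<xi> j" using d by (simp add: b_def d_def)
  have apex: "(\<Sum>k\<in>K. b k *\<^sub>R \<alpha> k) = (\<xi> j / d) *\<^sub>R dual K j"
  proof -
    have "(\<xi> j / d) *\<^sub>R dual K j = (\<xi> j / d) *\<^sub>R (\<Sum>k\<in>K. (dual K j \<bullet> dual K k) *\<^sub>R \<alpha> k)"
      using dual_expansion[OF K dual_span[OF K j]] by simp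
    then show ?thesis by (simp add: b_def scaleR_sum_right)
  qed
  have dualJ: "x \<bullet> dual J k = \<xi> k - b k" if "k \<in> J" for k
    using that j dual_remove[OF K j, of k]
    by (simp add: J_def \<xi>_def b_def d_def inner_diff_right inner_commute)
  have "((?T q)(j := \<tau>) \<in> wedge K x j) \<longleftrightarrow> q \<in> cell J x" if q: "q \<in> space (lborel_PiM J)" for q
  proof -
    define t where "t = (?T q)(j := \<tau>)"
    have tj: "t j = \<tau>" and tk: "\<And>k. k \<in> J \<Longrightarrow> t k = s * (q k + b k)"
      using KJ by (auto simp: t_def)
    have tsp: "t \<in> space (lborel_PiM K)"
      using KJ by (auto simp: t_def space_PiM PiE_iff extensional_def)
    have coeffs: "t k *\<^sub>R \<alpha> k = s *\<^sub>R ((q k + b k) *\<^sub>R \<alpha> k)" if "k \<in> J" for k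
      using tk[OF that] by simp
    have "vec K t = \<tau> *\<^sub>R \<alpha> j + (\<Sum>k\<in>J. t k *\<^sub>R \<alpha> k)"
      unfolding vec_def KJ(1) using KJ(2,3) by (simp add: tj)
    also have "\<dots> = s *\<^sub>R (\<xi> j *\<^sub>R \<alpha> j + (\<Sum>k\<in>J. (q k + b k) *\<^sub>R \<alpha> k))"
      by (simp add: coeffs s\<xi> scaleR_add_right scaleR_sum_right)
    finally have vec_sum: "vec K t = s *\<^sub>R (\<xi> j *\<^sub>R \<alpha> j + (\<Sum>k\<in>J. (q k + b k) *\<^sub>R \<alpha> k))" .
    have "(\<Sum>k\<in>K. b k *\<^sub>R \<alpha> k) = \<xi> j *\<^sub>R \<alpha> j + (\<Sum>k\<in>J. b k *\<^sub>R \<alpha> k)"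
      unfolding KJ(1) using KJ(2,3) by (simp add: bj)
    then have vec_eq: "vec K t = s *\<^sub>R ((\<xi> j / d) *\<^sub>R dual K j + vec J q)"
      unfolding vec_sum apex[symmetric] by (simp add: vec_def scaleR_add_left sum.distrib)
    have dom_J: "0 \<le> vec K t \<bullet> \<alpha> i \<longleftrightarrow> 0 \<le> vec J q \<bullet> \<alpha> i" if "i \<in> J" for i
    proof -
      have "i \<in> K" "i \<noteq> j" using that by (auto simp: J_def)
      then have "vec K t \<bullet> \<alpha> i = s * (vec J q \<bullet> \<alpha> i)"
        by (simp add: vec_eq inner_add_left dual_inner[OF K j])
      then show ?thesis using s by (simp add: zero_le_mult_iff)
    qed
    have bound_J: "t k * \<xi> j \<le> t j * \<xi> k \<longleftrightarrow> q k \<le> x \<bullet> dual J k" if "k \<in> J" for k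
    proof -
      have "t k * \<xi> j = (s * \<xi> j) * (q k + b k)" using tk[OF that] by simp
      then have "t k * \<xi> j = \<tau> * (q k + b k)" by (simp only: s\<xi>)
      then show ?thesis using \<tau>(1) dualJ[OF that] by (auto simp: tj)
    qed
    have dom_j: "0 \<le> vec K t \<bullet> \<alpha> j" if bd: "\<And>k. k \<in> J \<Longrightarrow> q k \<le> x \<bullet> dual J k"
    proof -
      have proj: "(\<Sum>k\<in>K. \<xi> k *\<^sub>R \<alpha> k) \<bullet> \<alpha> j = x \<bullet> \<alpha> j"
      proof -
        obtain y z where yz: "y \<in> span (\<alpha> ` K)"
          "\<And>w. w \<in> span (\<alpha> ` K) \<Longrightarrow> orthogonal z w" "x = y + z"
          by (rule orthogonal_subspace_decomp_exists[of "\<alpha> ` K" x]) auto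
        have "\<xi> k = y \<bullet> dual K k" if "k \<in> K" for k
          using yz(2)[OF dual_span[OF K that]] by (simp add: \<xi>_def yz(3) inner_add_left orthogonal_def)
        then have "(\<Sum>k\<in>K. \<xi> k *\<^sub>R \<alpha> k) = y"
          using dual_expansion[OF K yz(1)] by (simp cong: sum.cong)
        moreover have "z \<bullet> \<alpha> j = 0"
          using yz(2)[of "\<alpha> j"] j by (simp add: orthogonal_def span_base)
        ultimately show ?thesis by (simp add: yz(3) inner_add_left)
      qed
      have "(\<Sum>k\<in>J. \<xi> k * (\<alpha> k \<bullet> \<alpha> j)) \<le> (\<Sum>k\<in>J. (q k + b k) * (\<alpha> k \<bullet> \<alpha> j))"
      proof (intro sum_mono mult_right_mono_neg)
        fix k assume k: "k \<in> J"
        show "q k + b k \<le> \<xi> k" using bd[OF k] dualJ[OF k] by simp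
        show "\<alpha> k \<bullet> \<alpha> j \<le> 0" using k KJ K j by (intro obtuse) auto
      qed
      moreover have "x \<bullet> \<alpha> j = \<xi> j * (\<alpha> j \<bullet> \<alpha> j) + (\<Sum>k\<in>J. \<xi> k * (\<alpha> k \<bullet> \<alpha> j))"
        unfolding proj[symmetric] KJ(1) using KJ(2,3) by (simp add: inner_add_left inner_sum_left)
      moreover have "vec K t \<bullet> \<alpha> j
          = s * (\<xi> j * (\<alpha> j \<bullet> \<alpha> j) + (\<Sum>k\<in>J. (q k + b k) * (\<alpha> k \<bullet> \<alpha> j)))"
        by (simp add: vec_sum inner_add_left inner_sum_left)
      ultimately show ?thesis using dom s by simp
    qed
    have "t \<in> wedge K x j \<longleftrightarrow>
        (\<forall>i\<in>J. 0 \<le> vec J q \<bullet> \<alpha> i) \<and> (\<forall>k\<in>J. q k \<le> x \<bullet> dual J k) \<and> 0 \<le> vec K t \<bullet> \<alpha> j"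
    proof -
      have ball_K: "(\<forall>k\<in>K. P k) \<longleftrightarrow> P j \<and> (\<forall>k\<in>J. P k)" for P by (auto simp: KJ(1))
      have "t \<in> wedge K x j \<longleftrightarrow>
          (\<forall>i\<in>K. 0 \<le> vec K t \<bullet> \<alpha> i) \<and> (\<forall>k\<in>K. t k * \<xi> j \<le> t j * \<xi> k)"
        using tsp \<tau> by (simp add: wedge_def tj \<xi>_def)
      also have "\<dots> \<longleftrightarrow> (\<forall>i\<in>J. 0 \<le> vec K t \<bullet> \<alpha> i) \<and> (\<forall>k\<in>J. t k * \<xi> j \<le> t j * \<xi> k)
          \<and> 0 \<le> vec K t \<bullet> \<alpha> j"
        unfolding ball_K by auto
      finally show ?thesis using dom_J bound_J by auto
    qed
    also have "\<dots> \<longleftrightarrow> q \<in> cell J x"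
      using q dom_j by (auto simp: cell_def)
    finally show ?thesis by (simp add: t_def)
  qed
  then have eq: "{q \<in> space (lborel_PiM J). ?T q \<in> ?A} = cell J x"
    by (auto simp: space_PiM cell_def)
  have A: "?A \<in> sets (lborel_PiM J)"
  proof -
    have "(\<lambda>t. t(j := \<tau>)) \<in> measurable (lborel_PiM J) (lborel_PiM K)"
      unfolding KJ(1) by measurable
    then show ?thesis using wedge_sets[OF j] by measurable
  qed
  have "emeasure (lborel_PiM J) ?A = ennreal (s ^ card J) * emeasure (lborel_PiM J) (cell J x)"
    using emeasure_PiM_affine[OF KJ(3) A s, of b] unfolding eq .
  then show ?thesis unfolding J_def s_def \<xi>_def .
qed

lemma emeasure_wedge:
  assumes K: "K \<subseteq> N" and j: "j \<in> K" and dom: "0 \<le> x \<bullet> \<alpha> j" and pos: "0 < x \<bullet> dual K j"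
  shows "emeasure (lborel_PiM K) (wedge K x j)
    = ennreal ((x \<bullet> dual K j) / real (card K)) * emeasure (lborel_PiM (K - {j})) (cell (K - {j}) x)"
proof -
  define J where "J = K - {j}"
  define \<xi> where "\<xi> = x \<bullet> dual K j"
  define m where "m = card J"
  let ?E = "emeasure (lborel_PiM J) (cell J x)"
  let ?S = "\<lambda>\<tau>. {t \<in> space (lborel_PiM J). t(j := \<tau>) \<in> wedge K x j}"
  have KJ: "K = insert j J" "j \<notin> J" "finite J" using K j finite_sub[OF K] by (auto simp: J_def)
  have cardK: "card K = Suc m" using KJ by (simp add: m_def)
  have \<xi>: "\<xi> > 0" using pos by (simp add: \<xi>_def)
  have [measurable]: "wedge K x j \<in> sets (lborel_PiM (insert j J))"
    using wedge_sets[OF j] KJ by simp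
  have [measurable]: "(\<lambda>t. t(j := \<tau>)) \<in> measurable (lborel_PiM J) (lborel_PiM (insert j J))" for \<tau>
    by measurable
  have "emeasure (lborel_PiM K) (wedge K x j)
      = (\<integral>\<^sup>+t. indicator (wedge K x j) t \<partial>lborel_PiM (insert j J))"
    using KJ by simp
  also have "\<dots> = (\<integral>\<^sup>+\<tau>. \<integral>\<^sup>+t. indicator (wedge K x j) (t(j := \<tau>)) \<partial>lborel_PiM J \<partial>lborel)"
    using KJ by (intro lborel_product.product_nn_integral_insert_rev) auto
  also have "\<dots> = (\<integral>\<^sup>+\<tau>. emeasure (lborel_PiM J) (?S \<tau>) \<partial>lborel)"
  proof (rule nn_integral_cong)
    fix \<tau> :: real
    have "(\<integral>\<^sup>+t. indicator (wedge K x j) (t(j := \<tau>)) \<partial>lborel_PiM J)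
        = (\<integral>\<^sup>+t. indicator (?S \<tau>) t \<partial>lborel_PiM J)"
      by (intro nn_integral_cong) (auto simp: indicator_def)
    also have "\<dots> = emeasure (lborel_PiM J) (?S \<tau>)" by (rule nn_integral_indicator) measurable
    finally show "(\<integral>\<^sup>+t. indicator (wedge K x j) (t(j := \<tau>)) \<partial>lborel_PiM J)
        = emeasure (lborel_PiM J) (?S \<tau>)" .
  qed
  also have "\<dots> = (\<integral>\<^sup>+\<tau>. ennreal ((\<tau> / \<xi>) ^ m) * indicator {0..\<xi>} \<tau> * ?E \<partial>lborel)"
  proof (rule nn_integral_cong_AE)
    have "AE \<tau> in lborel. \<tau> \<noteq> (0::real)" by (rule AE_lborel_singleton)
    then show "AE \<tau> in lborel. emeasure (lborel_PiM J) (?S \<tau>)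
        = ennreal ((\<tau> / \<xi>) ^ m) * indicator {0..\<xi>} \<tau> * ?E"
    proof (rule AE_mp, intro AE_I2 impI)
      fix \<tau> :: real assume "\<tau> \<noteq> 0"
      show "emeasure (lborel_PiM J) (?S \<tau>) = ennreal ((\<tau> / \<xi>) ^ m) * indicator {0..\<xi>} \<tau> * ?E"
      proof (cases "\<tau> \<in> {0..\<xi>}")
        case True
        then have \<tau>: "0 < \<tau>" "\<tau> \<le> x \<bullet> dual K j" using \<open>\<tau> \<noteq> 0\<close> by (auto simp: \<xi>_def)
        have "emeasure (lborel_PiM J) (?S \<tau>) = ennreal ((\<tau> / \<xi>) ^ m) * ?E"
          using wedge_slice[OF K j dom pos \<tau>]
          unfolding J_def[symmetric] \<xi>_def[symmetric] m_def[symmetric] .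
        then show ?thesis by (simp only: indicator_simps(1)[OF True] mult_1_right)
      next
        case False
        have "t(j := \<tau>) \<notin> wedge K x j" for t
        proof
          assume w: "t(j := \<tau>) \<in> wedge K x j"
          have "0 \<le> (t(j := \<tau>)) j"
            by (rule vec_dominant_nonneg[OF K _ j, of "t(j := \<tau>)"]) (use w in \<open>auto simp: wedge_def\<close>)
          then show False using w False by (auto simp: wedge_def \<xi>_def)
        qed
        then show ?thesis using False by simp
      qed
    qed
  qed
  also have "\<dots> = (\<integral>\<^sup>+\<tau>. ennreal ((\<tau> / \<xi>) ^ m) * indicator {0..\<xi>} \<tau> \<partial>lborel) * ?E"
    by (rule nn_integral_multc) measurable
  also have "(\<integral>\<^sup>+\<tau>. ennreal ((\<tau> / \<xi>) ^ m) * indicator {0..\<xi>} \<tau> \<partial>lborel)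
      = ennreal (\<xi> ^ Suc m / (real (Suc m) * \<xi> ^ m) - 0 ^ Suc m / (real (Suc m) * \<xi> ^ m))"
  proof (rule nn_integral_FTC_Icc)
    fix \<tau> :: real
    have "((\<lambda>\<tau>. \<tau> ^ Suc m / (real (Suc m) * \<xi> ^ m)) has_real_derivative
        (real (Suc m) * \<tau> ^ m) / (real (Suc m) * \<xi> ^ m)) (at \<tau>)"
      by (intro DERIV_cdivide) (use DERIV_pow[of "Suc m" \<tau>] in simp)
    then show "((\<lambda>\<tau>. \<tau> ^ Suc m / (real (Suc m) * \<xi> ^ m)) has_real_derivative (\<tau> / \<xi>) ^ m) (at \<tau>)"
      by (simp add: power_divide del: of_nat_Suc power_Suc)
  qed (use \<xi> in auto)
  also have "\<xi> ^ Suc m / (real (Suc m) * \<xi> ^ m) - 0 ^ Suc m / (real (Suc m) * \<xi> ^ m)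
      = \<xi> / real (card K)"
    using \<xi> cardK by simp
  finally show ?thesis by (simp add: J_def \<xi>_def)
qed

lemma cell_eq_Union_wedge:
  assumes K: "K \<subseteq> N" "K \<noteq> {}" and pos: "\<And>k. k \<in> K \<Longrightarrow> 0 < x \<bullet> dual K k"
  shows "cell K x = (\<Union>j\<in>K. wedge K x j)"
proof (intro subset_antisym subsetI)
  fix t assume t: "t \<in> cell K x"
  define r where "r = (\<lambda>k. t k / (x \<bullet> dual K k))"
  have fin: "finite (r ` K)" "r ` K \<noteq> {}" using finite_sub K by auto
  obtain j where j: "j \<in> K" "Max (r ` K) = r j" using Max_in[OF fin] by auto
  have "t k * (x \<bullet> dual K j) \<le> t j * (x \<bullet> dual K k)" if "k \<in> K" for k
  proof -
    have "r k \<le> r j" using Max_ge[OF fin(1), of "r k"] that j by simp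
    then show ?thesis using pos[OF that] pos[OF j(1)] by (simp add: r_def field_simps)
  qed
  then have "t \<in> wedge K x j" using t j by (auto simp: cell_def wedge_def)
  then show "t \<in> (\<Union>j\<in>K. wedge K x j)" using j by blast
next
  fix t assume "t \<in> (\<Union>j\<in>K. wedge K x j)"
  then obtain j where j: "j \<in> K" and t: "t \<in> wedge K x j" by blast
  have "t k \<le> x \<bullet> dual K k" if "k \<in> K" for k
  proof -
    have "t k * (x \<bullet> dual K j) \<le> t j * (x \<bullet> dual K k)" using t that by (auto simp: wedge_def)
    also have "\<dots> \<le> (x \<bullet> dual K j) * (x \<bullet> dual K k)"
      using t pos[OF that] by (intro mult_right_mono) (auto simp: wedge_def)
    finally show ?thesis using pos[OF j] by (simp add: mult.commute)
  qed
  then show "t \<in> cell K x" using t by (auto simp: cell_def wedge_def)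
qed

lemma wedge_overlap:
  assumes K: "K \<subseteq> N" "j \<in> K" "k \<in> K" "j \<noteq> k" and pos: "0 < x \<bullet> dual K k"
  shows "wedge K x j \<inter> wedge K x k \<in> null_sets (lborel_PiM K)"
proof -
  define a where "a = (\<lambda>i. if i = j then x \<bullet> dual K k else if i = k then - (x \<bullet> dual K j) else 0)"
  have fin: "finite K" using finite_sub K by blast
  have "wedge K x j \<inter> wedge K x k \<subseteq> {t \<in> space (lborel_PiM K). (\<Sum>i\<in>K. a i * t i) = 0}"
  proof
    fix t assume t: "t \<in> wedge K x j \<inter> wedge K x k"
    then have "t k * (x \<bullet> dual K j) = t j * (x \<bullet> dual K k)"
      using K by (auto simp: wedge_def intro: antisym)
    moreover have "(\<Sum>i\<in>K. a i * t i) = (\<Sum>i\<in>{j,k}. a i * t i)"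
      using K fin by (intro sum.mono_neutral_right) (auto simp: a_def)
    ultimately have "(\<Sum>i\<in>K. a i * t i) = 0" using K(4) by (simp add: a_def mult.commute)
    then show "t \<in> {t \<in> space (lborel_PiM K). (\<Sum>i\<in>K. a i * t i) = 0}"
      using t by (auto simp: wedge_def)
  qed
  moreover have "{t \<in> space (lborel_PiM K). (\<Sum>i\<in>K. a i * t i) = 0} \<in> null_sets (lborel_PiM K)"
    using pos by (intro null_sets_PiM_hyperplane[OF fin K(2)]) (auto simp: a_def)
  ultimately show ?thesis
    by (rule null_sets_subset[rotated 2]) (use K in auto)
qed

lemma emeasure_cell:
  assumes "K \<subseteq> N" "card K = m" "\<And>i. i \<in> K \<Longrightarrow> 0 \<le> x \<bullet> \<alpha> i"
  shows "emeasure (lborel_PiM K) (cell K x) = ennreal (cell_vol m K x)"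
  using assms
proof (induction m arbitrary: K)
  case 0
  then have "K = {}" using finite_sub by auto
  then show ?case by (simp add: cell_def space_PiM PiM_empty)
next
  case (Suc m)
  note K = Suc.prems(1)
  have fin: "finite K" using finite_sub K by blast
  have IH: "emeasure (lborel_PiM (K - {j})) (cell (K - {j}) x) = ennreal (cell_vol m (K - {j}) x)"
    if "j \<in> K" for j
    using Suc.prems that fin by (intro Suc.IH) auto
  have nonneg: "0 \<le> x \<bullet> dual K j" if "j \<in> K" for j
    using inner_dual_nonneg[OF K that] Suc.prems by blast
  have vol_nonneg: "0 \<le> cell_vol m (K - {j}) x" for j
    using Suc.prems by (intro cell_vol_nonneg) auto
  show ?case
  proof (cases "\<forall>k\<in>K. 0 < x \<bullet> dual K k")
    case True
    have "emeasure (lborel_PiM K) (cell K x) = (\<Sum>j\<in>K. emeasure (lborel_PiM K) (wedge K x j))"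
    proof -
      have "K \<noteq> {}" using Suc.prems by auto
      then have eq: "cell K x = (\<Union>j\<in>K. wedge K x j)"
        using True by (intro cell_eq_Union_wedge[OF K]) auto
      show ?thesis
        unfolding eq using True K by (intro emeasure_UN_AE[OF fin] wedge_overlap wedge_sets) auto
    qed
    also have "\<dots> = (\<Sum>j\<in>K. ennreal ((x \<bullet> dual K j) / real (Suc m) * cell_vol m (K - {j}) x))"
      using True Suc.prems vol_nonneg
      by (intro sum.cong refl) (simp add: emeasure_wedge[OF K] IH ennreal_mult''[symmetric] del: of_nat_Suc)
    also have "\<dots> = ennreal (cell_vol (Suc m) K x)"
      using nonneg vol_nonneg by (subst sum_ennreal) (auto simp: sum_divide_distrib)
    finally show ?thesis .
  next
    case False
    then obtain i where i: "i \<in> K" "x \<bullet> dual K i \<le> 0" by force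
    then have zero: "x \<bullet> dual K i = 0" using nonneg[OF i(1)] by simp
    have "(x \<bullet> dual K j) * cell_vol m (K - {j}) x = 0" if j: "j \<in> K" for j
    proof (cases "j = i")
      case False
      have "x \<bullet> dual (K - {j}) i
          = - ((dual K i \<bullet> dual K j) / (dual K j \<bullet> dual K j) * (x \<bullet> dual K j))"
        using dual_remove[OF K j i(1)] False by (simp add: inner_diff_right zero)
      also have "\<dots> \<le> 0"
        using dual_dual_nonneg[OF K i(1) j] nonneg[OF j] by (auto intro!: mult_nonneg_nonneg)
      finally have "emeasure (lborel_PiM (K - {j})) (cell (K - {j}) x) = 0"
        using K i False by (intro cell_null[of _ i]) auto
      then show ?thesis using IH[OF j] vol_nonneg[of j] by simp
    qed (simp add: zero)
    then have "cell_vol (Suc m) K x = 0" by (simp add: sum.neutral del: of_nat_Suc)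
    then show ?thesis using cell_null[OF K i] by simp
  qed
qed

end

section \<open>Weyl groups\<close>

lemma linear_refl_root: "linear (refl_root a)"
  by (rule linearI) (simp_all add: refl_root_def inner_add_left algebra_simps)

lemma refl_root_self_adjoint: "refl_root a x \<bullet> y = x \<bullet> refl_root a y"
  by (simp add: refl_root_def coroot_def inner_diff_left inner_diff_right inner_commute)

lemma refl_root_involutive [simp]: "refl_root a (refl_root a x) = x"
  by (cases "a = 0") (simp_all add: refl_root_def coroot_def inner_diff_left algebra_simps)

lemma refl_root_self: "a \<noteq> 0 \<Longrightarrow> refl_root a a = - a"
  by (simp add: refl_root_def coroot_def) (metis minus_diff_eq scaleR_2 add_diff_cancel)

lemma orthogonal_refl_root: "orthogonal_transformation (refl_root a)"
  unfolding orthogonal_transformation_def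
  by (simp add: linear_refl_root refl_root_self_adjoint)

lemma refl_root_conjugate:
  assumes "orthogonal_transformation w"
  shows "refl_root (w a) (w x) = w (refl_root a x)"
  using assms unfolding orthogonal_transformation_def
  by (simp add: refl_root_def coroot_def linear_diff linear_scale)

locale root_basis =
  fixes \<Phi> :: "'a::euclidean_space set" and n :: nat and \<alpha> :: "nat \<Rightarrow> 'a"
  assumes root_system: "root_system \<Phi>" and simple_roots: "simple_roots \<Phi> n \<alpha>"
begin

lemma finite_roots: "finite \<Phi>" and zero_not_root: "0 \<notin> \<Phi>" and span_roots: "span \<Phi> = UNIV"
  and refl_root_in: "\<And>a b. a \<in> \<Phi> \<Longrightarrow> b \<in> \<Phi> \<Longrightarrow> refl_root a b \<in> \<Phi>"
  and reduced: "\<And>a t. a \<in> \<Phi> \<Longrightarrow> t *\<^sub>R a \<in> \<Phi> \<Longrightarrow> t = 1 \<or> t = -1"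
  using root_system unfolding root_system_def by auto

lemma simple_in: "i \<in> {1..n} \<Longrightarrow> \<alpha> i \<in> \<Phi>"
  using simple_roots unfolding simple_roots_def by auto

sublocale indexed_basis \<alpha> "{1..n}"
  by standard (use simple_roots in \<open>auto simp: simple_roots_def\<close>)

lemma root_signs:
  assumes "b \<in> \<Phi>"
  shows "(\<forall>i\<in>{1..n}. 0 \<le> b \<bullet> dual {1..n} i) \<or> (\<forall>i\<in>{1..n}. b \<bullet> dual {1..n} i \<le> 0)"
proof -
  obtain k :: "nat \<Rightarrow> nat" where "b = (\<Sum>i=1..n. real (k i) *\<^sub>R \<alpha> i) \<or> b = - (\<Sum>i=1..n. real (k i) *\<^sub>R \<alpha> i)"
    using assms simple_roots unfolding simple_roots_def by blast
  then show ?thesis using inner_sum_dual[of "{1..n}" _ "\<lambda>i. real (k i)"] by auto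
qed

lemma obtuse_simple:
  assumes "i \<in> {1..n}" "j \<in> {1..n}" "i \<noteq> j"
  shows "\<alpha> i \<bullet> \<alpha> j \<le> 0"
proof -
  let ?b = "refl_root (\<alpha> i) (\<alpha> j)"
  have "?b \<in> \<Phi>" using assms by (intro refl_root_in simple_in)
  moreover have "?b \<bullet> dual {1..n} j = 1" "?b \<bullet> dual {1..n} i = - (\<alpha> j \<bullet> coroot (\<alpha> i))"
    using assms by (simp_all add: refl_root_def inner_diff_left simple_inner_dual)
  ultimately have "\<alpha> j \<bullet> coroot (\<alpha> i) \<le> 0" using root_signs[of ?b] assms by force
  moreover have "\<alpha> i \<bullet> \<alpha> i > 0" using simple_nonzero assms by simp
  ultimately show ?thesis by (simp add: coroot_def inner_commute mult_le_0_iff divide_le_0_iff)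
qed

sublocale obtuse_basis \<alpha> "{1..n}"
  by standard (rule obtuse_simple)

lemma uminus_root: "b \<in> \<Phi> \<Longrightarrow> - b \<in> \<Phi>"
  using refl_root_in[of b b] refl_root_self[of b] zero_not_root by force

lemma span_simple: "span (\<alpha> ` {1..n}) = UNIV"
proof -
  have "\<Phi> \<subseteq> span (\<alpha> ` {1..n})"
  proof
    fix b assume "b \<in> \<Phi>"
    then obtain k :: "nat \<Rightarrow> nat"
      where "b = (\<Sum>i=1..n. real (k i) *\<^sub>R \<alpha> i) \<or> b = - (\<Sum>i=1..n. real (k i) *\<^sub>R \<alpha> i)"
      using simple_roots unfolding simple_roots_def by blast
    moreover have "(\<Sum>i=1..n. real (k i) *\<^sub>R \<alpha> i) \<in> span (\<alpha> ` {1..n})"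
      by (intro span_sum span_scale span_base) auto
    ultimately show "b \<in> span (\<alpha> ` {1..n})" using span_neg by blast
  qed
  then show ?thesis using span_roots span_minimal[of \<Phi> "span (\<alpha> ` {1..n})"] by auto
qed

lemma expansion: "y = (\<Sum>k=1..n. (y \<bullet> dual {1..n} k) *\<^sub>R \<alpha> k)"
  by (rule dual_expansion[OF subset_refl]) (simp only: span_simple UNIV_I)

lemma inner_expansion: "y \<bullet> z = (\<Sum>k=1..n. (y \<bullet> dual {1..n} k) * (\<alpha> k \<bullet> z))"
  by (subst expansion[of y]) (simp add: inner_sum_left)

lemma eq_zeroI: "(\<And>i. i \<in> {1..n} \<Longrightarrow> y \<bullet> dual {1..n} i = 0) \<Longrightarrow> y = 0"
  by (subst expansion[of y]) simp

definition pos :: "'a \<Rightarrow> bool" where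
  "pos b \<longleftrightarrow> b \<in> \<Phi> \<and> (\<forall>i\<in>{1..n}. 0 \<le> b \<bullet> dual {1..n} i)"

lemma pos_or_neg: "b \<in> \<Phi> \<Longrightarrow> pos b \<or> pos (- b)"
  using root_signs[of b] uminus_root[of b] by (auto simp: pos_def)

lemma pos_uminus: "pos b \<Longrightarrow> \<not> pos (- b)"
proof
  assume "pos b" "pos (- b)"
  then have "b = 0" by (intro eq_zeroI) (force simp: pos_def)
  then show False using \<open>pos b\<close> zero_not_root by (simp add: pos_def)
qed

lemma simple_pos: "i \<in> {1..n} \<Longrightarrow> pos (\<alpha> i)"
  using dual_inner[of "{1..n}" _ i] by (auto simp: pos_def simple_in inner_commute)

lemma refl_simple_inner_dual:
  "i \<in> {1..n} \<Longrightarrow> j \<in> {1..n} \<Longrightarrow> i \<noteq> j \<Longrightarrow> refl_root (\<alpha> i) x \<bullet> dual {1..n} j = x \<bullet> dual {1..n} j"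
  by (simp add: refl_root_def inner_diff_left simple_inner_dual)

lemma refl_simple_pos:
  assumes b: "pos b" and i: "i \<in> {1..n}" and ne: "b \<noteq> \<alpha> i"
  shows "pos (refl_root (\<alpha> i) b)"
proof -
  let ?b = "refl_root (\<alpha> i) b"
  have "?b \<in> \<Phi>" using refl_root_in[OF simple_in[OF i]] b by (simp add: pos_def)
  have "\<exists>j\<in>{1..n}. j \<noteq> i \<and> 0 < b \<bullet> dual {1..n} j"
  proof (rule ccontr)
    assume "\<not> ?thesis"
    then have zero: "b \<bullet> dual {1..n} j = 0" if "j \<in> {1..n}" "j \<noteq> i" for j
      using b that by (force simp: pos_def)
    have "b = (\<Sum>k\<in>{1..n}. (b \<bullet> dual {1..n} k) *\<^sub>R \<alpha> k)" by (rule expansion)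
    also have "\<dots> = (\<Sum>k\<in>{i}. (b \<bullet> dual {1..n} k) *\<^sub>R \<alpha> k)"
      using i zero by (intro sum.mono_neutral_right) auto
    finally have b_eq: "b = (b \<bullet> dual {1..n} i) *\<^sub>R \<alpha> i" by simp
    then have "b \<bullet> dual {1..n} i = 1 \<or> b \<bullet> dual {1..n} i = -1"
      using reduced[OF simple_in[OF i]] b by (metis pos_def)
    moreover have "0 \<le> b \<bullet> dual {1..n} i" using b i by (simp add: pos_def)
    ultimately have "b \<bullet> dual {1..n} i = 1" by linarith
    then show False using b_eq ne by simp
  qed
  then obtain j where j: "j \<in> {1..n}" "j \<noteq> i" "0 < b \<bullet> dual {1..n} j" by blast
  then have "0 < ?b \<bullet> dual {1..n} j" using refl_simple_inner_dual i by simp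
  then have "\<not> pos (- ?b)" using j by (force simp: pos_def)
  then show ?thesis using pos_or_neg \<open>?b \<in> \<Phi>\<close> by blast
qed

primrec word :: "nat list \<Rightarrow> 'a \<Rightarrow> 'a" where
  "word [] = id"
| "word (i # is) = refl_root (\<alpha> i) \<circ> word is"

lemma word_append: "word (is @ js) = word is \<circ> word js"
  by (induction "is") (auto simp: fun_eq_iff)

lemma word_rev: "word (rev is) (word is x) = x"
  by (induction "is" arbitrary: x) (auto simp: word_append)

lemma orthogonal_word: "orthogonal_transformation (word is)"
proof (induction "is")
  case Nil
  show ?case by (simp add: orthogonal_transformation_def linear_id)
next
  case (Cons i "is")
  then show ?case
    using orthogonal_transformation_compose[OF orthogonal_refl_root] by (simp only: word.simps)
qed

lemma word_root: "set is \<subseteq> {1..n} \<Longrightarrow> b \<in> \<Phi> \<Longrightarrow> word is b \<in> \<Phi>"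
  by (induction "is") (auto intro!: refl_root_in simple_in)

lemma word_in_weyl: "set is \<subseteq> {1..n} \<Longrightarrow> word is \<in> weyl_group \<Phi>"
proof (induction "is")
  case (Cons i "is")
  then have "i \<in> {1..n}" "word is \<in> weyl_group \<Phi>" by auto
  then show ?case unfolding word.simps by (intro weyl_group.weyl_refl simple_in)
qed (simp add: weyl_group.weyl_id)

lemma pos_root_word:
  assumes "pos b"
  shows "\<exists>is k. set is \<subseteq> {1..n} \<and> k \<in> {1..n} \<and> b = word is (\<alpha> k)"
proof (rule ccontr)
  assume neg: "\<not> ?thesis"
  define S where "S = {b. pos b \<and> \<not> (\<exists>is k. set is \<subseteq> {1..n} \<and> k \<in> {1..n} \<and> b = word is (\<alpha> k))}"
  define h where "h = (\<lambda>b. \<Sum>i=1..n. b \<bullet> dual {1..n} i)"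
  have "S \<subseteq> \<Phi>" by (auto simp: S_def pos_def)
  then have fin: "finite S" using finite_roots finite_subset by blast
  have "S \<noteq> {}" using assms neg by (auto simp: S_def)
  then obtain c where c: "c \<in> S" and min: "\<And>y. y \<in> S \<Longrightarrow> h c \<le> h y"
    using arg_min_if_finite[OF fin, of h] by (metis not_less)
  have posc: "pos c" using c by (simp add: S_def)
  have "\<exists>i\<in>{1..n}. 0 < c \<bullet> \<alpha> i"
  proof (rule ccontr)
    assume "\<not> ?thesis"
    then have "c \<bullet> c \<le> 0"
      unfolding inner_expansion[of c c] using posc
      by (intro sum_nonpos mult_nonneg_nonpos) (auto simp: pos_def inner_commute not_less)
    then have "c = 0" by (metis inner_eq_zero_iff inner_ge_zero antisym)
    then show False using posc zero_not_root by (simp add: pos_def)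
  qed
  then obtain i where i: "i \<in> {1..n}" "0 < c \<bullet> \<alpha> i" by blast
  have not_word: "c \<noteq> word is (\<alpha> k)" if "set is \<subseteq> {1..n}" "k \<in> {1..n}" for "is" k
    using c that by (auto simp: S_def)
  have "c \<noteq> \<alpha> i" using not_word[of "[]" i] i by simp
  then have pos': "pos (refl_root (\<alpha> i) c)" using refl_simple_pos posc i by blast
  have "h (refl_root (\<alpha> i) c) = h c - (c \<bullet> coroot (\<alpha> i)) * h (\<alpha> i)"
    by (simp add: h_def refl_root_def inner_diff_left sum_subtractf sum_distrib_left)
  also have "h (\<alpha> i) = (\<Sum>j\<in>{1..n}. if j = i then 1 else 0)"
    unfolding h_def using dual_inner[of "{1..n}" _ i] i by (intro sum.cong) (auto simp: inner_commute)
  also have "\<dots> = 1" using i by simp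
  finally have "h (refl_root (\<alpha> i) c) < h c"
    using i simple_nonzero[of i] by (simp add: coroot_def)
  then have "refl_root (\<alpha> i) c \<notin> S" using min by force
  then obtain "is" k where w: "set is \<subseteq> {1..n}" "k \<in> {1..n}" "refl_root (\<alpha> i) c = word is (\<alpha> k)"
    using pos' by (auto simp: S_def)
  then have "c = word (i # is) (\<alpha> k)" by (metis comp_apply refl_root_involutive word.simps(2))
  then show False using not_word[of "i # is" k] w i by simp
qed

lemma root_word:
  assumes "b \<in> \<Phi>"
  obtains "is" k where "set is \<subseteq> {1..n}" "k \<in> {1..n}" "b = word is (\<alpha> k)"
proof (cases "pos b")
  case True
  then show ?thesis using pos_root_word that by blast
next
  case False
  then have "pos (- b)" using pos_or_neg assms by blast
  then obtain "is" k where w: "set is \<subseteq> {1..n}" "k \<in> {1..n}" "- b = word is (\<alpha> k)"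
    using pos_root_word by blast
  have "b = word is (- \<alpha> k)"
    using w(3) orthogonal_word[of "is"]
    by (metis linear_neg minus_minus orthogonal_transformation_linear)
  also have "- \<alpha> k = refl_root (\<alpha> k) (\<alpha> k)" using refl_root_self simple_nonzero w by metis
  finally have "b = word (is @ [k]) (\<alpha> k)" by (simp add: word_append)
  then show ?thesis using that[of "is @ [k]" k] w by simp
qed

lemma weyl_word:
  assumes "w \<in> weyl_group \<Phi>"
  shows "\<exists>is. set is \<subseteq> {1..n} \<and> w = word is"
  using assms
proof induction
  case weyl_id
  show ?case by (intro exI[of _ "[]"]) simp
next
  case (weyl_refl a w)
  then obtain "is" where w: "set is \<subseteq> {1..n}" "w = word is" by blast
  obtain js k where a: "set js \<subseteq> {1..n}" "k \<in> {1..n}" "a = word js (\<alpha> k)"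
    using root_word weyl_refl by blast
  have "refl_root a y = word (js @ [k] @ rev js) y" for y
  proof -
    have "refl_root a y = refl_root (word js (\<alpha> k)) (word js (word (rev js) y))"
      using word_rev[of "rev js" y] a by simp
    also have "\<dots> = word js (refl_root (\<alpha> k) (word (rev js) y))"
      by (rule refl_root_conjugate[OF orthogonal_word])
    finally show ?thesis by (simp add: word_append)
  qed
  then have "refl_root a \<circ> w = word ((js @ [k] @ rev js) @ is)"
    unfolding word_append[of "js @ [k] @ rev js" "is"] w by (simp add: fun_eq_iff)
  then show ?case using w a by (intro exI[of _ "(js @ [k] @ rev js) @ is"]) auto
qed

text \<open>The letter at which the root turns negative acts there on its own simple root, so it is
  conjugate to the reflection in \<open>\<alpha> k\<close> and can be deleted.\<close>

lemma exchange:
  assumes "set is \<subseteq> {1..n}" "k \<in> {1..n}" "\<not> pos (word is (\<alpha> k))"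
  shows "\<exists>js. set js \<subseteq> {1..n} \<and> Suc (length js) = length is \<and> word is \<circ> refl_root (\<alpha> k) = word js"
  using assms
proof (induction "is")
  case Nil
  then show ?case using simple_pos by simp
next
  case (Cons i "is")
  show ?case
  proof (cases "pos (word is (\<alpha> k))")
    case True
    then have "word is (\<alpha> k) = \<alpha> i" using Cons.prems refl_simple_pos by auto
    then have "refl_root (\<alpha> i) (word is y) = word is (refl_root (\<alpha> k) y)" for y
      using refl_root_conjugate[OF orthogonal_word] by metis
    then have "word (i # is) \<circ> refl_root (\<alpha> k) = word is"
      by (auto simp: fun_eq_iff)
    moreover have "set is \<subseteq> {1..n}" "Suc (length is) = length (i # is)" using Cons.prems by auto
    ultimately show ?thesis by blast
  next
    case False
    moreover have "set is \<subseteq> {1..n}" using Cons.prems by simp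
    ultimately obtain js where js: "set js \<subseteq> {1..n}" "Suc (length js) = length is"
      "word is \<circ> refl_root (\<alpha> k) = word js"
      using Cons.IH Cons.prems(2) by blast
    have "word (i # is) \<circ> refl_root (\<alpha> k) = word (i # js)"
      unfolding word.simps comp_assoc js(3) ..
    moreover have "set (i # js) \<subseteq> {1..n}" "Suc (length (i # js)) = length (i # is)"
      using js Cons.prems(1) by auto
    ultimately show ?thesis by blast
  qed
qed

lemma weyl_id_if_pos:
  assumes w: "w \<in> weyl_group \<Phi>" and pos: "\<And>b. pos b \<Longrightarrow> pos (w b)"
  shows "w = id"
proof -
  define P where "P = (\<lambda>is. set is \<subseteq> {1..n} \<and> w = word is)"
  have "\<exists>is. P is" using weyl_word[OF w] by (simp add: P_def)
  then obtain "is" where P: "P is" and min: "\<And>js. P js \<Longrightarrow> length is \<le> length js"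
    using ex_has_least_nat[of P _ length] by blast
  show ?thesis
  proof (cases "is" rule: rev_cases)
    case Nil
    then show ?thesis using P by (simp add: P_def)
  next
    case (snoc js k)
    have jk: "set js \<subseteq> {1..n}" "k \<in> {1..n}" "w = word js \<circ> refl_root (\<alpha> k)"
      using P snoc by (auto simp: P_def word_append)
    have "w (\<alpha> k) = - word js (\<alpha> k)"
      using jk refl_root_self[of "\<alpha> k"] simple_nonzero[of k] orthogonal_word[of js]
      by (simp add: linear_neg orthogonal_transformation_linear)
    moreover have "pos (w (\<alpha> k))" using pos simple_pos jk by blast
    ultimately have "\<not> pos (word js (\<alpha> k))" using pos_uminus by fastforce
    then obtain ks where "set ks \<subseteq> {1..n}" "Suc (length ks) = length js" "w = word ks"
      using exchange[OF jk(1,2)] jk(3) by metis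
    then have "P ks" "length ks < length is" using snoc by (auto simp: P_def)
    then show ?thesis using min by force
  qed
qed

lemma orthogonal_weyl: "w \<in> weyl_group \<Phi> \<Longrightarrow> orthogonal_transformation w"
  using weyl_word orthogonal_word by blast

lemma linear_weyl: "w \<in> weyl_group \<Phi> \<Longrightarrow> linear w"
  by (simp add: orthogonal_weyl orthogonal_transformation_linear)

lemma inner_weyl: "w \<in> weyl_group \<Phi> \<Longrightarrow> w x \<bullet> w y = x \<bullet> y"
  using orthogonal_weyl by (auto simp: orthogonal_transformation_def)

lemma weyl_root: "w \<in> weyl_group \<Phi> \<Longrightarrow> b \<in> \<Phi> \<Longrightarrow> w b \<in> \<Phi>"
  using weyl_word word_root by blast

lemma weyl_comp:
  assumes "w \<in> weyl_group \<Phi>" "w' \<in> weyl_group \<Phi>"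
  shows "w \<circ> w' \<in> weyl_group \<Phi>"
proof -
  obtain "is" js where "set is \<subseteq> {1..n}" "w = word is" "set js \<subseteq> {1..n}" "w' = word js"
    using weyl_word assms by metis
  then show ?thesis using word_in_weyl[of "is @ js"] by (simp add: word_append)
qed

lemma weyl_inverse:
  assumes "w \<in> weyl_group \<Phi>"
  obtains w' where "w' \<in> weyl_group \<Phi>" "\<And>x. w' (w x) = x" "\<And>x. w (w' x) = x"
proof -
  obtain "is" where "set is \<subseteq> {1..n}" "w = word is" using weyl_word assms by blast
  then show ?thesis
    using that[of "word (rev is)"] word_in_weyl[of "rev is"] word_rev[of "is"] word_rev[of "rev is"]
    by simp
qed

lemma finite_weyl: "finite (weyl_group \<Phi>)"
proof (rule inj_on_finite)
  show "inj_on (\<lambda>w. restrict w \<Phi>) (weyl_group \<Phi>)"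
  proof (rule inj_onI)
    fix w w' assume w: "w \<in> weyl_group \<Phi>" "w' \<in> weyl_group \<Phi>" "restrict w \<Phi> = restrict w' \<Phi>"
    have "w b = w' b" if "b \<in> \<Phi>" for b using fun_cong[OF w(3), of b] that by simp
    then have "w x = w' x" for x
      using linear_eq_on_span[OF linear_weyl[OF w(1)] linear_weyl[OF w(2)], of \<Phi> x] span_roots by auto
    then show "w = w'" by blast
  qed
  show "(\<lambda>w. restrict w \<Phi>) ` weyl_group \<Phi> \<subseteq> (\<Pi>\<^sub>E b\<in>\<Phi>. \<Phi>)" using weyl_root by auto
  show "finite (\<Pi>\<^sub>E b\<in>\<Phi>. \<Phi>)" using finite_roots by (intro finite_PiE)
qed

definition dominant :: "'a \<Rightarrow> bool" where
  "dominant x \<longleftrightarrow> (\<forall>i\<in>{1..n}. 0 \<le> x \<bullet> \<alpha> i)"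

definition regular :: "'a \<Rightarrow> bool" where
  "regular x \<longleftrightarrow> (\<forall>i\<in>{1..n}. 0 < x \<bullet> \<alpha> i)"

lemma dominant_inner_pos: "dominant x \<Longrightarrow> pos b \<Longrightarrow> 0 \<le> x \<bullet> b"
  unfolding inner_commute[of x b] inner_expansion[of b x]
  by (intro sum_nonneg mult_nonneg_nonneg) (auto simp: dominant_def pos_def inner_commute)

lemma regular_inner_pos:
  assumes "regular x" "pos b"
  shows "0 < x \<bullet> b"
proof -
  have "\<exists>i\<in>{1..n}. b \<bullet> dual {1..n} i \<noteq> 0"
    using eq_zeroI[of b] zero_not_root assms by (metis pos_def)
  then obtain i where "i \<in> {1..n}" "0 < b \<bullet> dual {1..n} i"
    using assms by (force simp: pos_def)
  then show ?thesis
    unfolding inner_commute[of x b] inner_expansion[of b x]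
    using assms by (intro sum_pos2[of _ i]) (auto simp: regular_def pos_def inner_commute less_imp_le)
qed

lemma weyl_id_if_regular:
  assumes w: "w \<in> weyl_group \<Phi>" and y: "regular y" "dominant (w y)"
  shows "w = id"
proof -
  obtain w' where w': "w' \<in> weyl_group \<Phi>" "\<And>x. w' (w x) = x" "\<And>x. w (w' x) = x"
    using weyl_inverse w by blast
  have "w' = id"
  proof (rule weyl_id_if_pos[OF w'(1)], rule ccontr)
    fix b assume b: "pos b" "\<not> pos (w' b)"
    then have "pos (- w' b)" using pos_or_neg weyl_root[OF w'(1)] by (auto simp: pos_def)
    then have "y \<bullet> w' b < 0" using regular_inner_pos[OF y(1)] by force
    moreover have "y \<bullet> w' b = w y \<bullet> b" using inner_weyl[OF w, of y "w' b"] w' by simp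
    ultimately show False using dominant_inner_pos[OF y(2) b(1)] by simp
  qed
  then show ?thesis using w' by (auto simp: fun_eq_iff)
qed

lemma weyl_maximum:
  assumes \<rho>: "regular \<rho>"
  obtains w where "w \<in> weyl_group \<Phi>" "dominant (w y)" "\<And>w'. w' \<in> weyl_group \<Phi> \<Longrightarrow> w' y \<bullet> \<rho> \<le> w y \<bullet> \<rho>"
proof -
  have ne: "weyl_group \<Phi> \<noteq> {}" using weyl_group.weyl_id by blast
  have "finite ((\<lambda>w. w y \<bullet> \<rho>) ` weyl_group \<Phi>)" (is "finite ?V") using finite_weyl by blast
  then have "Max ?V \<in> ?V" using ne by (intro Max_in) auto
  then obtain w where w: "w \<in> weyl_group \<Phi>" "w y \<bullet> \<rho> = Max ?V" by force
  have max: "w' y \<bullet> \<rho> \<le> w y \<bullet> \<rho>" if "w' \<in> weyl_group \<Phi>" for w'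
    using finite_weyl that by (simp add: w(2))
  have "dominant (w y)"
    unfolding dominant_def
  proof (intro ballI, rule ccontr)
    fix i assume i: "i \<in> {1..n}" "\<not> 0 \<le> w y \<bullet> \<alpha> i"
    have "refl_root (\<alpha> i) \<circ> w \<in> weyl_group \<Phi>" using i w by (intro weyl_group.weyl_refl simple_in)
    from max[OF this] have "0 \<le> (w y \<bullet> coroot (\<alpha> i)) * (\<alpha> i \<bullet> \<rho>)"
      by (simp add: refl_root_def inner_diff_left)
    moreover have "0 < \<alpha> i \<bullet> \<rho>" using \<rho> i by (simp add: regular_def inner_commute)
    moreover have "w y \<bullet> coroot (\<alpha> i) < 0"
      using i simple_nonzero[of i] by (simp add: coroot_def mult_less_0_iff divide_less_0_iff)
    ultimately show False by (meson mult_neg_pos not_less)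
  qed
  then show ?thesis using that w max by blast
qed

definition rho :: 'a where
  "rho = (\<Sum>i=1..n. dual {1..n} i)"

lemma rho_inner: "i \<in> {1..n} \<Longrightarrow> rho \<bullet> \<alpha> i = 1"
proof -
  assume i: "i \<in> {1..n}"
  have "rho \<bullet> \<alpha> i = (\<Sum>j=1..n. if j = i then 1 else 0)"
    unfolding rho_def inner_sum_left using dual_inner[of "{1..n}" _ i] i by (intro sum.cong) auto
  then show ?thesis using i by simp
qed

lemma regular_rho: "regular rho"
  by (simp add: regular_def rho_inner)

lemma regular_perturb: "dominant x \<Longrightarrow> 0 < \<epsilon> \<Longrightarrow> regular (x + \<epsilon> *\<^sub>R rho)"
  by (auto simp: regular_def dominant_def inner_add_left rho_inner add_nonneg_pos)

lemma dominant_dual: "i \<in> {1..n} \<Longrightarrow> dominant (dual {1..n} i)"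
  using dual_inner[of "{1..n}" i] by (auto simp: dominant_def)

lemma weyl_le_dominant:
  assumes x: "dominant x" and w: "w \<in> weyl_group \<Phi>" and i: "i \<in> {1..n}"
  shows "w x \<bullet> dual {1..n} i \<le> x \<bullet> dual {1..n} i"
proof -
  let ?\<theta> = "dual {1..n} i"
  define A where "A = (x - w x) \<bullet> ?\<theta>"
  define B where "B = (rho - w rho) \<bullet> ?\<theta> + (x - w x) \<bullet> rho"
  define C where "C = (rho - w rho) \<bullet> rho"
  have "0 \<le> A + \<epsilon> * B + \<epsilon> ^ 2 * C" if \<epsilon>: "0 < \<epsilon>" for \<epsilon> :: real
  proof -
    let ?x = "x + \<epsilon> *\<^sub>R rho" and ?y = "?\<theta> + \<epsilon> *\<^sub>R rho"
    have "regular ?y" using \<epsilon> dominant_dual[OF i] by (rule regular_perturb[rotated])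
    then obtain w0 where w0: "w0 \<in> weyl_group \<Phi>" "dominant (w0 ?x)"
      "\<And>w'. w' \<in> weyl_group \<Phi> \<Longrightarrow> w' ?x \<bullet> ?y \<le> w0 ?x \<bullet> ?y"
      using weyl_maximum by metis
    have "w0 = id" using w0 \<epsilon> x by (intro weyl_id_if_regular[OF w0(1), of ?x] regular_perturb)
    then have "w ?x \<bullet> ?y \<le> ?x \<bullet> ?y" using w0(3)[OF w] by simp
    then show ?thesis
      using linear_weyl[OF w]
      by (simp add: A_def B_def C_def linear_add linear_scale inner_add_left inner_add_right
          inner_diff_left inner_diff_right algebra_simps power2_eq_square)
  qed
  then have ev: "eventually (\<lambda>\<epsilon>. 0 \<le> A + \<epsilon> * B + \<epsilon> ^ 2 * C) (at_right 0)"
    by (auto simp: eventually_at_right_field intro: exI[of _ 1])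
  have lim: "((\<lambda>\<epsilon>. A + \<epsilon> * B + \<epsilon> ^ 2 * C) \<longlongrightarrow> A) (at_right 0)"
    by (auto intro!: tendsto_eq_intros)
  have "0 \<le> A" by (rule tendsto_lowerbound[OF lim ev]) simp
  then show ?thesis by (simp add: A_def inner_diff_left)
qed

lemma inner_nonneg_if_cone:
  assumes "\<And>i. i \<in> {1..n} \<Longrightarrow> 0 \<le> z \<bullet> dual {1..n} i" "dominant v"
  shows "0 \<le> z \<bullet> v"
  unfolding inner_expansion[of z v] using assms
  by (intro sum_nonneg mult_nonneg_nonneg) (auto simp: dominant_def inner_commute)

lemma weight_polytope_dominant:
  assumes x: "dominant x"
  shows "{y \<in> weight_polytope \<Phi> x. dominant y}
    = {y. dominant y \<and> (\<forall>i\<in>{1..n}. y \<bullet> dual {1..n} i \<le> x \<bullet> dual {1..n} i)}"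
    (is "?L = ?R")
proof (intro subset_antisym subsetI)
  fix y assume y: "y \<in> ?L"
  let ?H = "{y. \<forall>i\<in>{1..n}. y \<bullet> dual {1..n} i \<le> x \<bullet> dual {1..n} i}"
  have "?H = (\<Inter>i\<in>{1..n}. {y. dual {1..n} i \<bullet> y \<le> x \<bullet> dual {1..n} i})"
    by (auto simp: inner_commute)
  then have "convex ?H" by (simp add: convex_INT convex_halfspace_le)
  then have "weight_polytope \<Phi> x \<subseteq> ?H"
    unfolding weight_polytope_def using weyl_le_dominant[OF x]
    by (intro hull_minimal) auto
  then show "y \<in> ?R" using y by blast
next
  fix y assume y: "y \<in> ?R"
  let ?O = "(\<lambda>w. w x) ` weyl_group \<Phi>"
  have "y \<in> weight_polytope \<Phi> x"
  proof (rule ccontr)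
    assume "y \<notin> weight_polytope \<Phi> x"
    then have "y \<notin> convex hull ?O" by (simp add: weight_polytope_def)
    moreover have "closed (convex hull ?O)"
      using finite_weyl by (intro compact_imp_closed finite_imp_compact_convex_hull) simp
    ultimately obtain a b where ab: "a \<bullet> y < b" "\<And>z. z \<in> convex hull ?O \<Longrightarrow> b < a \<bullet> z"
      using separating_hyperplane_closed_point[of "convex hull ?O" y] by auto
    define v where "v = - a"
    have sep: "v \<bullet> w x < v \<bullet> y" if "w \<in> weyl_group \<Phi>" for w
      using ab(1) ab(2)[of "w x"] that by (auto simp: v_def hull_inc)
    obtain w where w: "w \<in> weyl_group \<Phi>" "dominant (w v)"
      using weyl_maximum[OF regular_rho] by metis
    obtain w' where w': "w' \<in> weyl_group \<Phi>" "\<And>x. w' (w x) = x" "\<And>x. w (w' x) = x"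
      using weyl_inverse w by blast
    have "v \<bullet> y = w y \<bullet> w v" using inner_weyl[OF w(1)] by (simp add: inner_commute)
    also have "\<dots> \<le> y \<bullet> w v"
      using inner_nonneg_if_cone[of "y - w y" "w v"] weyl_le_dominant[of y w] w y
      by (auto simp: inner_diff_left)
    also have "\<dots> \<le> x \<bullet> w v"
      using inner_nonneg_if_cone[of "x - y" "w v"] w y by (auto simp: inner_diff_left)
    also have "\<dots> = v \<bullet> w' x"
      using inner_weyl[OF w(1), of v "w' x"] w' by (simp add: inner_commute)
    finally show False using sep[OF w'(1)] by simp
  qed
  then show "y \<in> ?L" using y by simp
qed

end

section \<open>The volume of a weight polytope\<close>

context root_basis
begin

lemma weyl_weight_polytope:
  assumes w: "w \<in> weyl_group \<Phi>"
  shows "w y \<in> weight_polytope \<Phi> x \<longleftrightarrow> y \<in> weight_polytope \<Phi> x"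
proof -
  have image: "v ` weight_polytope \<Phi> x \<subseteq> weight_polytope \<Phi> x" if v: "v \<in> weyl_group \<Phi>" for v
  proof -
    have "v ` weight_polytope \<Phi> x = convex hull (v ` (\<lambda>w. w x) ` weyl_group \<Phi>)"
      unfolding weight_polytope_def by (rule convex_hull_linear_image[OF linear_weyl[OF v]])
    also have "v ` (\<lambda>w. w x) ` weyl_group \<Phi> \<subseteq> (\<lambda>w. w x) ` weyl_group \<Phi>"
    proof clarify
      fix w assume "w \<in> weyl_group \<Phi>"
      from imageI[OF weyl_comp[OF v this], of "\<lambda>w. w x"]
      show "v (w x) \<in> (\<lambda>w. w x) ` weyl_group \<Phi>" by simp
    qed
    then have "convex hull (v ` (\<lambda>w. w x) ` weyl_group \<Phi>) \<subseteq> weight_polytope \<Phi> x"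
      unfolding weight_polytope_def by (rule hull_mono)
    finally show ?thesis .
  qed
  obtain w' where "w' \<in> weyl_group \<Phi>" "\<And>x. w' (w x) = x" using weyl_inverse w by blast
  then show ?thesis using image[OF w] image[of w'] by (metis image_subset_iff)
qed

lemma weight_polytope_borel [measurable]: "weight_polytope \<Phi> x \<in> sets borel"
  unfolding weight_polytope_def
  by (intro borel_closed compact_imp_closed finite_imp_compact_convex_hull finite_imageI finite_weyl)

lemma dominant_measurable [measurable]: "Measurable.pred borel dominant"
  unfolding dominant_def by measurable

lemma weyl_measurable: "w \<in> weyl_group \<Phi> \<Longrightarrow> w \<in> borel_measurable borel"
  by (intro borel_measurable_continuous_onI linear_continuous_on)
    (simp add: linear_weyl linear_conv_bounded_linear[symmetric])

lemma root_hyperplanes_null: "(\<Union>a\<in>\<Phi>. {y. a \<bullet> y = 0}) \<in> null_sets lborel"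
proof (intro null_sets_UN' countable_finite finite_roots)
  fix a assume "a \<in> \<Phi>"
  then have "negligible {y. a \<bullet> y = 0}" using zero_not_root by (intro negligible_hyperplane) auto
  moreover have "{y. a \<bullet> y = 0} \<in> sets borel" by (intro borel_closed closed_hyperplane)
  ultimately show "{y. a \<bullet> y = 0} \<in> null_sets lborel"
    by (auto simp: negligible_iff_null_sets null_sets_def)
qed

lemma emeasure_weight_polytope:
  "emeasure lborel (weight_polytope \<Phi> x)
    = of_nat (card (weyl_group \<Phi>)) * emeasure lborel {y \<in> weight_polytope \<Phi> x. dominant y}"
proof -
  let ?P = "weight_polytope \<Phi> x"
  let ?D = "{y \<in> ?P. dominant y}"
  have D: "?D \<in> sets borel" by measurable
  have vimage_sets: "w -` ?D \<in> sets borel" if "w \<in> weyl_group \<Phi>" for w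
    using measurable_sets[OF weyl_measurable[OF that] D] by simp
  have vimage_eq: "w -` ?D = {y \<in> ?P. dominant (w y)}" if "w \<in> weyl_group \<Phi>" for w
    using weyl_weight_polytope[OF that] by auto
  have cover: "?P = (\<Union>w\<in>weyl_group \<Phi>. w -` ?D)"
  proof (intro subset_antisym subsetI)
    fix y assume "y \<in> ?P"
    moreover obtain w where "w \<in> weyl_group \<Phi>" "dominant (w y)"
      using weyl_maximum[OF regular_rho] by metis
    ultimately show "y \<in> (\<Union>w\<in>weyl_group \<Phi>. w -` ?D)" using vimage_eq by blast
  qed (use vimage_eq in blast)
  have "emeasure lborel (\<Union>w\<in>weyl_group \<Phi>. w -` ?D)
      = (\<Sum>w\<in>weyl_group \<Phi>. emeasure lborel (w -` ?D))"
  proof (rule emeasure_UN_AE[OF finite_weyl])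
    fix v w assume v: "v \<in> weyl_group \<Phi>" and w: "w \<in> weyl_group \<Phi>" and ne: "v \<noteq> w"
    have "v -` ?D \<inter> w -` ?D \<subseteq> (\<Union>a\<in>\<Phi>. {y. a \<bullet> y = 0})"
    proof
      fix y assume y: "y \<in> v -` ?D \<inter> w -` ?D"
      obtain v' where v': "v' \<in> weyl_group \<Phi>" "\<And>x. v' (v x) = x" "\<And>x. v (v' x) = x"
        using weyl_inverse v by blast
      have "\<not> regular (v y)"
      proof
        assume "regular (v y)"
        moreover have "dominant ((w \<circ> v') (v y))" using y v' by simp
        ultimately have "w \<circ> v' = id" using weyl_id_if_regular weyl_comp w v' by blast
        then have "w (v' (v x)) = v x" for x by (metis comp_apply id_apply)
        then have "w x = v x" for x by (simp add: v')
        then show False using ne by auto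
      qed
      then obtain i where i: "i \<in> {1..n}" "v y \<bullet> \<alpha> i = 0"
        using y by (force simp: regular_def dominant_def)
      have "v' (\<alpha> i) \<bullet> y = 0" using inner_weyl[OF v, of "v' (\<alpha> i)" y] v' i by (simp add: inner_commute)
      moreover have "v' (\<alpha> i) \<in> \<Phi>" using weyl_root v' simple_in i by blast
      ultimately show "y \<in> (\<Union>a\<in>\<Phi>. {y. a \<bullet> y = 0})" by blast
    qed
    then show "v -` ?D \<inter> w -` ?D \<in> null_sets lborel"
      using vimage_sets v w by (intro null_sets_subset[OF root_hyperplanes_null]) auto
  qed (use vimage_sets in simp)
  also have "\<dots> = (\<Sum>w\<in>weyl_group \<Phi>. emeasure lborel ?D)"
    using D by (intro sum.cong refl emeasure_lborel_orthogonal_vimage orthogonal_weyl)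
  finally show ?thesis using cover by simp
qed

lemma vec_inner_dual: "i \<in> {1..n} \<Longrightarrow> vec {1..n} t \<bullet> dual {1..n} i = t i"
  unfolding vec_def by (rule inner_sum_dual) auto

lemma parallelepiped_eq: "parallelepiped n \<alpha> = {y. \<forall>i\<in>{1..n}. 0 \<le> y \<bullet> dual {1..n} i \<and> y \<bullet> dual {1..n} i \<le> 1}"
proof (intro subset_antisym subsetI)
  fix y assume "y \<in> parallelepiped n \<alpha>"
  then obtain t where "y = vec {1..n} t" "\<forall>i\<in>{1..n}. 0 \<le> t i \<and> t i \<le> 1"
    by (auto simp: parallelepiped_def vec_def)
  then show "y \<in> {y. \<forall>i\<in>{1..n}. 0 \<le> y \<bullet> dual {1..n} i \<and> y \<bullet> dual {1..n} i \<le> 1}"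
    using vec_inner_dual by simp
next
  fix y assume y: "y \<in> {y. \<forall>i\<in>{1..n}. 0 \<le> y \<bullet> dual {1..n} i \<and> y \<bullet> dual {1..n} i \<le> 1}"
  show "y \<in> parallelepiped n \<alpha>"
    unfolding parallelepiped_def using expansion[of y] y
    by (intro CollectI exI[of _ "\<lambda>i. y \<bullet> dual {1..n} i"]) auto
qed

lemma emeasure_box_PiM:
  assumes "a \<le> b"
  shows "emeasure (lborel_PiM {1..n}) {t \<in> space (lborel_PiM {1..n}). \<forall>i\<in>{1..n}. a \<le> t i \<and> t i \<le> b}
    = ennreal (b - a) ^ n"
proof -
  have "{t \<in> space (lborel_PiM {1..n}). \<forall>i\<in>{1..n}. a \<le> t i \<and> t i \<le> b} = (\<Pi>\<^sub>E i\<in>{1..n}. {a..b})"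
    by (auto simp: space_PiM PiE_iff extensional_def)
  then show ?thesis using assms by (simp add: lborel_product.emeasure_PiM)
qed

lemma vec_measurable [measurable]: "vec K \<in> borel_measurable (lborel_PiM K)"
  unfolding vec_def by measurable

lemma emeasure_coordinates:
  assumes A: "A \<in> sets borel"
  shows "emeasure (lborel_PiM {1..n}) {t \<in> space (lborel_PiM {1..n}). vec {1..n} t \<in> A}
      * emeasure lborel (parallelepiped n \<alpha>) = emeasure lborel A"
proof -
  let ?N = "{1..n}"
  let ?Q = "lborel_PiM ?N"
  let ?M = "distr ?Q borel (vec ?N)"
  let ?box = "\<lambda>a b. {y. \<forall>i\<in>?N. a \<le> y \<bullet> dual ?N i \<and> y \<bullet> dual ?N i \<le> b}"
  have M: "emeasure ?M B = emeasure ?Q {t \<in> space ?Q. vec ?N t \<in> B}" if "B \<in> sets borel" for B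
    using that by (simp add: emeasure_distr vimage_def Int_def conj_commute)
  have box_sets: "?box a b \<in> sets borel" for a b :: real by measurable
  have M_box: "emeasure ?M (?box a b) = ennreal (b - a) ^ n" if "a \<le> b" for a b :: real
  proof -
    have "{t \<in> space ?Q. vec ?N t \<in> ?box a b} = {t \<in> space ?Q. \<forall>i\<in>?N. a \<le> t i \<and> t i \<le> b}"
      using vec_inner_dual by auto
    then show ?thesis using M[OF box_sets] emeasure_box_PiM[OF that] by simp
  qed
  have inv: "distr ?M borel ((+) y) = ?M" for y
  proof (rule measure_eqI)
    fix B assume "B \<in> sets (distr ?M borel ((+) y))"
    then have B [measurable]: "B \<in> sets borel" by simp
    let ?B = "{t \<in> space ?Q. vec ?N t \<in> B}"
    have "emeasure ?M B = emeasure ?Q ?B" by (rule M[OF B])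
    also have "\<dots> = ennreal (1 ^ card ?N) * emeasure ?Q
        {t \<in> space ?Q. (\<lambda>k\<in>?N. 1 * (t k + y \<bullet> dual ?N k)) \<in> ?B}"
      by (rule emeasure_PiM_affine) (simp_all, measurable)
    also have "{t \<in> space ?Q. (\<lambda>k\<in>?N. 1 * (t k + y \<bullet> dual ?N k)) \<in> ?B}
        = {t \<in> space ?Q. vec ?N t \<in> (+) y -` B}"
    proof -
      have "vec ?N (\<lambda>k\<in>?N. 1 * (t k + y \<bullet> dual ?N k)) = y + vec ?N t" for t
      proof -
        have "vec ?N (\<lambda>k\<in>?N. 1 * (t k + y \<bullet> dual ?N k))
            = (\<Sum>k\<in>?N. (y \<bullet> dual ?N k) *\<^sub>R \<alpha> k + t k *\<^sub>R \<alpha> k)"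
          unfolding vec_def by (rule sum.cong) (simp_all add: scaleR_add_left)
        then show ?thesis using expansion[of y] by (simp add: vec_def sum.distrib)
      qed
      then show ?thesis by (auto simp: space_PiM)
    qed
    also have "ennreal (1 ^ card ?N) * emeasure ?Q {t \<in> space ?Q. vec ?N t \<in> (+) y -` B}
        = emeasure ?M ((+) y -` B)"
      using measurable_sets[of "(+) y" borel borel B] by (subst M) simp_all
    also have "\<dots> = emeasure (distr ?M borel ((+) y)) B" by (simp add: emeasure_distr)
    finally show "emeasure (distr ?M borel ((+) y)) B = emeasure ?M B" by simp
  qed simp
  have sf: "sigma_finite_measure ?M"
  proof (rule sigma_finite_measure.intro, intro exI conjI ballI)
    let ?C = "range (\<lambda>m::nat. ?box (- real m) (real m))"
    show "countable ?C" by simp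
    show "?C \<subseteq> sets ?M" using box_sets by auto
    show "\<Union> ?C = space ?M"
    proof -
      have "\<exists>m::nat. y \<in> ?box (- real m) (real m)" for y
      proof -
        obtain m :: nat where m: "Max ((\<lambda>i. \<bar>y \<bullet> dual ?N i\<bar>) ` ?N) \<le> real m"
          using real_arch_simple by blast
        have "\<bar>y \<bullet> dual ?N i\<bar> \<le> real m" if "i \<in> ?N" for i
          using m that by (intro order_trans[OF Max_ge m]) auto
        then show ?thesis by (intro exI[of _ m]) (auto simp: abs_le_iff minus_le_iff)
      qed
      then show ?thesis by auto
    qed
    fix a assume "a \<in> ?C"
    then obtain m :: nat where "a = ?box (- real m) (real m)" by auto
    then have "emeasure ?M a = ennreal (real m - - real m) ^ n" by (simp only: M_box)
    then show "emeasure ?M a \<noteq> \<infinity>" by (simp add: ennreal_power)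
  qed
  have scale: "emeasure ?M B * emeasure lborel (?box (-1) 1) = emeasure lborel B * emeasure ?M (?box (-1) 1)"
    if "B \<in> sets borel" for B
    using that box_sets by (intro translation_invariant_proportional sf inv) auto
  have two_n_top: "(2::ennreal) ^ n \<noteq> top"
    using ennreal_power[of 2 n] by (metis ennreal_neq_top ennreal_numeral zero_le_numeral)
  have M_sym: "emeasure ?M (?box (-1) 1) = 2 ^ n" using M_box[of "-1" 1] by simp
  have par: "parallelepiped n \<alpha> = ?box 0 1" by (rule parallelepiped_eq)
  have "emeasure lborel (?box (-1) 1) = emeasure lborel (parallelepiped n \<alpha>) * 2 ^ n"
    using scale[OF box_sets, of 0 1] M_box[of 0 1] M_sym by (simp add: par)
  then have "emeasure ?M A * emeasure lborel (parallelepiped n \<alpha>) * 2 ^ n = emeasure lborel A * 2 ^ n"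
    using scale[OF A] M_sym by (simp add: mult.assoc)
  then have "emeasure ?M A * emeasure lborel (parallelepiped n \<alpha>) = emeasure lborel A"
    using two_n_top by (simp add: mult.commute[of _ "2 ^ n"] ennreal_mult_cancel_left)
  then show ?thesis using M[OF A] by simp
qed

lemma measure_parallelepiped_pos: "0 < measure lborel (parallelepiped n \<alpha>)"
proof -
  have "emeasure lborel (parallelepiped n \<alpha>) \<noteq> 0"
  proof
    assume "emeasure lborel (parallelepiped n \<alpha>) = 0"
    then have "emeasure lborel (UNIV :: 'a set) = 0" using emeasure_coordinates[of UNIV] by simp
    then show False by (simp add: emeasure_lborel_UNIV)
  qed
  moreover have "bounded (parallelepiped n \<alpha>)"
  proof (rule boundedI)
    fix y assume "y \<in> parallelepiped n \<alpha>"
    then obtain t where y: "y = (\<Sum>i=1..n. t i *\<^sub>R \<alpha> i)" and t: "\<forall>i\<in>{1..n}. 0 \<le> t i \<and> t i \<le> 1"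
      by (auto simp: parallelepiped_def)
    show "norm y \<le> (\<Sum>i=1..n. norm (\<alpha> i))"
      unfolding y using t by (intro sum_norm_le) (auto intro!: mult_left_le_one_le)
  qed
  then have "emeasure lborel (parallelepiped n \<alpha>) < \<infinity>" by (rule emeasure_bounded_finite)
  ultimately show ?thesis by (simp add: measure_def enn2real_positive_iff zero_less_iff_neq_zero)
qed

theorem normalized_vol_weight_polytope:
  assumes x: "dominant x"
  shows "normalized_vol n \<alpha> (weight_polytope \<Phi> x) = real (card (weyl_group \<Phi>)) * cell_vol n {1..n} x"
proof -
  let ?D = "{y \<in> weight_polytope \<Phi> x. dominant y}"
  have "{t \<in> space (lborel_PiM {1..n}). vec {1..n} t \<in> ?D} = cell {1..n} x"
  proof -
    have "(\<forall>i\<in>{1..n}. vec {1..n} t \<bullet> dual {1..n} i \<le> c i) \<longleftrightarrow> (\<forall>i\<in>{1..n}. t i \<le> c i)" for t c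
      using vec_inner_dual by (intro ball_cong) auto
    then show ?thesis
      unfolding weight_polytope_dominant[OF x]
      unfolding cell_def dominant_def ball_conj_distrib by (simp only: mem_Collect_eq)
  qed
  moreover have "?D \<in> sets borel" by measurable
  ultimately have "emeasure lborel ?D
      = emeasure (lborel_PiM {1..n}) (cell {1..n} x) * emeasure lborel (parallelepiped n \<alpha>)"
    using emeasure_coordinates[of ?D] by simp
  also have "emeasure (lborel_PiM {1..n}) (cell {1..n} x) = ennreal (cell_vol n {1..n} x)"
    using x by (intro emeasure_cell) (auto simp: dominant_def)
  finally have "measure lborel (weight_polytope \<Phi> x) = real (card (weyl_group \<Phi>))
      * (cell_vol n {1..n} x * measure lborel (parallelepiped n \<alpha>))"
    using cell_vol_nonneg[of "{1..n}" x n] x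
    unfolding measure_def emeasure_weight_polytope by (simp add: enn2real_mult dominant_def)
  then show ?thesis
    using measure_parallelepiped_pos by (simp add: normalized_vol_def)
qed

text \<open>A connected component of the Dynkin diagram would split the root system: every root is
  conjugate to a simple one, and reflections preserve the support in a union of components.\<close>

lemma dynkin_connected:
  assumes irr: "irreducible_root_system \<Phi>" and I: "I \<subseteq> {1..n}" "I \<noteq> {}"
    and closed: "\<And>i j. i \<in> I \<Longrightarrow> j \<in> {1..n} - I \<Longrightarrow> \<alpha> i \<bullet> \<alpha> j = 0"
  shows "I = {1..n}"
proof (rule ccontr)
  assume "I \<noteq> {1..n}"
  then obtain j where j: "j \<in> {1..n} - I" using I by blast
  obtain i where i: "i \<in> I" using I by blast
  define S where "S = (\<lambda>J. {b \<in> \<Phi>. \<forall>k\<in>{1..n} - J. b \<bullet> dual {1..n} k = 0})"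
  have orth: "b \<bullet> y = 0" if "b \<in> S J" "\<And>k. k \<in> J \<Longrightarrow> k \<in> {1..n} \<Longrightarrow> \<alpha> k \<bullet> y = 0" for b J y
    unfolding inner_expansion[of b y] using that by (intro sum.neutral) (auto simp: S_def)
  have simple: "\<alpha> k \<in> S J" if "k \<in> J" "k \<in> {1..n}" for k J
    using that simple_in[of k] by (auto simp: S_def simple_inner_dual)
  have refl: "refl_root (\<alpha> k) b \<in> S J"
    if b: "b \<in> S J" and k: "k \<in> {1..n}"
      and J: "\<And>l m. l \<in> J \<Longrightarrow> l \<in> {1..n} \<Longrightarrow> m \<in> {1..n} - J \<Longrightarrow> \<alpha> l \<bullet> \<alpha> m = 0" for k b J
  proof (cases "k \<in> J")
    case True
    then have "refl_root (\<alpha> k) b \<bullet> dual {1..n} l = 0" if "l \<in> {1..n} - J" for l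
      using that b refl_simple_inner_dual[OF k, of l b] by (auto simp: S_def)
    then show ?thesis using b refl_root_in[OF simple_in[OF k], of b] by (simp add: S_def)
  next
    case False
    have "b \<bullet> \<alpha> k = 0" using J k False by (intro orth[OF b]) auto
    then show ?thesis using b by (simp add: refl_root_def coroot_def)
  qed
  have J2: "\<alpha> l \<bullet> \<alpha> m = 0" if "l \<in> {1..n} - I" "m \<in> I" for l m
    using closed[OF that(2,1)] by (simp add: inner_commute)
  have "b \<in> S I \<union> S ({1..n} - I)" if b: "b \<in> \<Phi>" for b
  proof -
    obtain "is" k where w: "set is \<subseteq> {1..n}" "k \<in> {1..n}" "b = word is (\<alpha> k)"
      using root_word[OF b] by blast
    have "word is (\<alpha> k) \<in> S I \<union> S ({1..n} - I)"
      using w(1)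
    proof (induction "is")
      case Nil
      then show ?case using simple[of k I] simple[of k "{1..n} - I"] w(2) by auto
    next
      case (Cons m "is")
      then have m: "m \<in> {1..n}" and IH: "word is (\<alpha> k) \<in> S I \<union> S ({1..n} - I)" by auto
      show ?case
        using IH refl[OF _ m, of _ I] refl[OF _ m, of _ "{1..n} - I"] closed J2 by auto
    qed
    then show ?thesis using w by simp
  qed
  then have union: "S I \<union> S ({1..n} - I) = \<Phi>" by (auto simp: S_def)
  have disjoint: "S I \<inter> S ({1..n} - I) = {}"
  proof -
    have False if b: "b \<in> S I" "b \<in> S ({1..n} - I)" for b
    proof -
      have "b = 0" using b I by (intro eq_zeroI) (auto simp: S_def)
      then show False using b zero_not_root by (simp add: S_def)
    qed
    then show ?thesis by blast
  qed
  have orth_S: "a \<bullet> b = 0" if "a \<in> S I" "b \<in> S ({1..n} - I)" for a b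
  proof (rule orth[OF that(1)])
    fix k assume k: "k \<in> I" "k \<in> {1..n}"
    have "b \<bullet> \<alpha> k = 0" using k J2 by (intro orth[OF that(2)]) auto
    then show "\<alpha> k \<bullet> b = 0" by (simp add: inner_commute)
  qed
  have "\<alpha> i \<in> S I" "\<alpha> j \<in> S ({1..n} - I)" using simple[of i I] simple[of j "{1..n} - I"] i j I by auto
  then have "S I \<noteq> {}" "S ({1..n} - I) \<noteq> {}" by blast+
  then have "\<exists>A B. A \<noteq> {} \<and> B \<noteq> {} \<and> A \<union> B = \<Phi> \<and> A \<inter> B = {} \<and> (\<forall>a\<in>A. \<forall>b\<in>B. a \<bullet> b = 0)"
    using union disjoint orth_S by (intro exI[of _ "S I"] exI[of _ "S ({1..n} - I)"] conjI ballI)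
  then show False using irr by (simp add: irreducible_root_system_def)
qed

lemma rank_pos: "n \<ge> 1"
proof (rule ccontr)
  assume "\<not> 1 \<le> n"
  then have "(UNIV :: 'a set) = {0}" using span_simple by simp
  then show False using nonempty_Basis nonzero_Basis by blast
qed

end

section \<open>The coefficients of the volume polynomial\<close>

text \<open>Induction on the number of variables; in each step the identity is read as one between
  univariate polynomials, which agree at infinitely many points.\<close>

lemma monomials_independent:
  fixes D :: "('i \<Rightarrow> nat) \<Rightarrow> real"
  assumes "finite I" "finite C"
    and "\<And>c c'. c \<in> C \<Longrightarrow> c' \<in> C \<Longrightarrow> (\<And>i. i \<in> I \<Longrightarrow> c i = c' i) \<Longrightarrow> c = c'"
    and "\<And>u :: 'i \<Rightarrow> real. (\<And>i. i \<in> I \<Longrightarrow> 0 \<le> u i) \<Longrightarrow> (\<Sum>c\<in>C. D c * (\<Prod>i\<in>I. u i ^ c i)) = 0"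
    and "c \<in> C"
  shows "D c = 0"
  using assms
proof (induction I arbitrary: C c rule: finite_induct)
  case empty
  then have "C = {c}" by blast
  then show ?case using empty(3)[of "\<lambda>_. 0"] by simp
next
  case (insert j I)
  define C' where "C' = {c' \<in> C. c' j = c j}"
  show ?case
  proof (rule insert.IH[of C'])
    show "finite C'" "c \<in> C'" using insert.prems by (auto simp: C'_def)
    show "a = b" if "a \<in> C'" "b \<in> C'" "\<And>i. i \<in> I \<Longrightarrow> a i = b i" for a b
    proof (rule insert.prems(2))
      show "a i = b i" if "i \<in> insert j I" for i
        using that \<open>a \<in> C'\<close> \<open>b \<in> C'\<close> \<open>\<And>i. i \<in> I \<Longrightarrow> a i = b i\<close> by (auto simp: C'_def)
    qed (use that in \<open>auto simp: C'_def\<close>)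
    fix u :: "'i \<Rightarrow> real" assume u: "\<And>i. i \<in> I \<Longrightarrow> 0 \<le> u i"
    define p where "p = (\<Sum>c\<in>C. monom (D c * (\<Prod>i\<in>I. u i ^ c i)) (c j))"
    have "poly p z = 0" if "0 \<le> z" for z
    proof -
      have "(\<Prod>i\<in>insert j I. (u(j := z)) i ^ c i) = z ^ c j * (\<Prod>i\<in>I. u i ^ c i)" for c :: "'i \<Rightarrow> nat"
      proof -
        have "(\<Prod>i\<in>I. (u(j := z)) i ^ c i) = (\<Prod>i\<in>I. u i ^ c i)"
          using insert.hyps by (intro prod.cong) auto
        then show ?thesis using insert.hyps by simp
      qed
      then have "poly p z = (\<Sum>c\<in>C. D c * (\<Prod>i\<in>insert j I. (u(j := z)) i ^ c i))"
        by (simp add: p_def poly_sum poly_monom mult_ac)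
      also have "\<dots> = 0" using u that by (intro insert.prems(3)) auto
      finally show ?thesis .
    qed
    then have "{0..} \<subseteq> {z. poly p z = 0}" by auto
    then have "infinite {z. poly p z = 0}" using infinite_Ici infinite_super by blast
    then have "p = 0" using poly_roots_finite by blast
    then have "coeff p (c j) = 0" by simp
    moreover have "coeff p (c j) = (\<Sum>c'\<in>C. if c' j = c j then D c' * (\<Prod>i\<in>I. u i ^ c' i) else 0)"
      by (simp add: p_def coeff_sum)
    moreover have "\<dots> = (\<Sum>c\<in>C'. D c * (\<Prod>i\<in>I. u i ^ c i))"
      using insert.prems(1) by (simp add: C'_def sum.inter_filter)
    ultimately show "(\<Sum>c\<in>C'. D c * (\<Prod>i\<in>I. u i ^ c i)) = 0" by simp
  qed
qed

context indexed_basis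
begin

text \<open>\<open>flag_sum \<omega> K is\<close> expands, along all orders in which the elements of \<open>K\<close> can be removed, the
  iterated partial derivative of the volume polynomial in the directions \<open>is\<close>.\<close>

primrec flag_sum :: "(nat \<Rightarrow> 'a) \<Rightarrow> nat set \<Rightarrow> nat list \<Rightarrow> real" where
  "flag_sum \<omega> K [] = 1"
| "flag_sum \<omega> K (i # is) = (\<Sum>j\<in>K. (\<omega> i \<bullet> dual K j) * flag_sum \<omega> (K - {j}) is)"

lemma flag_sum_swap:
  assumes K: "K \<subseteq> N"
  shows "flag_sum \<omega> K (a # b # is) = flag_sum \<omega> K (b # a # is)"
proof -
  define g where "g = (\<lambda>j l. flag_sum \<omega> (K - {j} - {l}) is)"
  define p where "p = (\<lambda>a j. \<omega> a \<bullet> dual K j)"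
  define r where "r = (\<lambda>j l. (dual K l \<bullet> dual K j) / (dual K j \<bullet> dual K j))"
  define S where "S = (\<lambda>a b. \<Sum>j\<in>K. \<Sum>l\<in>K. if l = j then 0 else p a j * p b l * g j l)"
  define R where "R = (\<lambda>a b. \<Sum>j\<in>K. \<Sum>l\<in>K. if l = j then 0 else p a j * p b j * r j l * g j l)"
  have fin: "finite K" using finite_sub K by blast
  have expand: "flag_sum \<omega> K (a # b # is) = S a b - R a b" for a b
  proof -
    have inner: "p a j * (\<Sum>l\<in>K - {j}. (\<omega> b \<bullet> dual (K - {j}) l) * g j l)
        = (\<Sum>l\<in>K. if l = j then 0 else p a j * p b l * g j l)
          - (\<Sum>l\<in>K. if l = j then 0 else p a j * p b j * r j l * g j l)" if j: "j \<in> K" for j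
    proof -
      have "p a j * (\<Sum>l\<in>K - {j}. (\<omega> b \<bullet> dual (K - {j}) l) * g j l)
          = (\<Sum>l\<in>K - {j}. p a j * p b l * g j l - p a j * p b j * r j l * g j l)"
        unfolding sum_distrib_left
      proof (intro sum.cong refl)
        fix l assume "l \<in> K - {j}"
        then have d: "dual (K - {j}) l = dual K l - r j l *\<^sub>R dual K j"
          using dual_remove[OF K j, of l] by (simp add: r_def)
        show "p a j * ((\<omega> b \<bullet> dual (K - {j}) l) * g j l)
            = p a j * p b l * g j l - p a j * p b j * r j l * g j l"
          unfolding d p_def by (simp add: inner_diff_right algebra_simps)
      qed
      also have "\<dots> = (\<Sum>l\<in>K. if l = j then 0 else p a j * p b l * g j l - p a j * p b j * r j l * g j l)"
        using fin by (intro sum.mono_neutral_cong_left) auto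
      also have "\<dots> = (\<Sum>l\<in>K. (if l = j then 0 else p a j * p b l * g j l)
          - (if l = j then 0 else p a j * p b j * r j l * g j l))"
        by (intro sum.cong) auto
      finally show ?thesis by (simp add: sum_subtractf)
    qed
    have "flag_sum \<omega> K (a # b # is)
        = (\<Sum>j\<in>K. p a j * (\<Sum>l\<in>K - {j}. (\<omega> b \<bullet> dual (K - {j}) l) * g j l))"
      by (simp add: p_def g_def)
    also have "\<dots> = (\<Sum>j\<in>K. (\<Sum>l\<in>K. if l = j then 0 else p a j * p b l * g j l)
        - (\<Sum>l\<in>K. if l = j then 0 else p a j * p b j * r j l * g j l))"
      by (intro sum.cong refl inner)
    also have "\<dots> = S a b - R a b"
      by (simp only: S_def R_def sum_subtractf)
    finally show ?thesis .
  qed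
  have "g j l = g l j" for j l by (simp add: g_def Diff_insert2[symmetric] insert_commute)
  then have "S a b = S b a"
    unfolding S_def by (subst sum.swap, intro sum.cong refl) (auto simp: mult_ac)
  moreover have "R a b = R b a" unfolding R_def by (intro sum.cong refl) (simp add: mult_ac)
  ultimately show ?thesis by (simp only: expand)
qed

lemma flag_sum_mset:
  assumes "mset xs = mset ys" "K \<subseteq> N"
  shows "flag_sum \<omega> K xs = flag_sum \<omega> K ys"
  using assms
proof (induction "length xs" arbitrary: xs ys K)
  case 0
  then show ?case by simp
next
  case (Suc m)
  then obtain a as where xs: "xs = a # as" by (cases xs) auto
  with Suc.prems obtain b bs where ys: "ys = b # bs" by (cases ys) auto
  have cong: "flag_sum \<omega> K (i # as) = flag_sum \<omega> K (i # bs)"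
    if "mset as = mset bs" "length as = m" for i as bs
  proof -
    have "flag_sum \<omega> (K - {j}) as = flag_sum \<omega> (K - {j}) bs" for j
      using Suc.hyps(1)[of as bs "K - {j}"] that Suc.prems(2) by blast
    then show ?thesis by simp
  qed
  show ?case
  proof (cases "a = b")
    case True
    then show ?thesis using cong[of as bs a] Suc.prems Suc.hyps xs ys by simp
  next
    case False
    have "add_mset a (mset as) = add_mset b (mset bs)" using Suc.prems xs ys by simp
    then obtain M where M: "mset as = add_mset b M" "mset bs = add_mset a M"
      using False by (auto simp: add_eq_conv_ex)
    obtain cs where cs: "mset cs = M" using ex_mset by blast
    have "length as = m" "length bs = m"
      using Suc.hyps xs M by (simp, metis size_mset size_add_mset length_Cons Suc_inject Suc.hyps(2))
    then have "flag_sum \<omega> K (a # as) = flag_sum \<omega> K (a # b # cs)"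
      "flag_sum \<omega> K (b # bs) = flag_sum \<omega> K (b # a # cs)"
      using M cs by (auto intro!: cong simp del: flag_sum.simps)
    then show ?thesis using flag_sum_swap[OF Suc.prems(2), of \<omega> a b cs] xs ys by simp
  qed
qed

end

context obtuse_basis
begin

lemma cell_vol_flag_sum:
  assumes "finite J" and x: "x = (\<Sum>i\<in>J. u i *\<^sub>R \<omega> i)"
  shows "fact m * cell_vol m K x
    = (\<Sum>is | set is \<subseteq> J \<and> length is = m. prod_list (map u is) * flag_sum \<omega> K is)"
proof (induction m arbitrary: K)
  case 0
  have "{is. set is \<subseteq> J \<and> length is = 0} = {[]}" by auto
  then show ?case by simp
next
  case (Suc m)
  let ?L = "{is. set is \<subseteq> J \<and> length is = m}"
  have "fact (Suc m) * cell_vol (Suc m) K x = (\<Sum>j\<in>K. (x \<bullet> dual K j) * (fact m * cell_vol m (K - {j}) x))"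
  proof -
    have "fact (Suc m) * cell_vol (Suc m) K x = fact m * (\<Sum>j\<in>K. (x \<bullet> dual K j) * cell_vol m (K - {j}) x)"
      by (simp add: fact_Suc del: of_nat_Suc)
    then show ?thesis by (simp add: sum_distrib_left mult.left_commute del: fact_Suc cell_vol.simps)
  qed
  also have "\<dots> = (\<Sum>j\<in>K. (\<Sum>i\<in>J. u i * (\<omega> i \<bullet> dual K j))
      * (\<Sum>is\<in>?L. prod_list (map u is) * flag_sum \<omega> (K - {j}) is))"
  proof -
    have "x \<bullet> dual K j = (\<Sum>i\<in>J. u i * (\<omega> i \<bullet> dual K j))" for j by (simp add: x inner_sum_left)
    then show ?thesis by (simp only: Suc.IH)
  qed
  also have "\<dots> = (\<Sum>j\<in>K. \<Sum>is\<in>?L. \<Sum>i\<in>J. prod_list (map u (i # is)) * ((\<omega> i \<bullet> dual K j) * flag_sum \<omega> (K - {j}) is))"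
    unfolding sum_product by (subst sum.swap) (simp add: mult_ac)
  also have "\<dots> = (\<Sum>is\<in>?L. \<Sum>i\<in>J. prod_list (map u (i # is)) * flag_sum \<omega> K (i # is))"
    unfolding flag_sum.simps sum_distrib_left
    by (rule trans[OF sum.swap], rule sum.cong[OF refl], rule sum.swap)
  also have "\<dots> = (\<Sum>(is, i)\<in>?L \<times> J. prod_list (map u (i # is)) * flag_sum \<omega> K (i # is))"
    by (rule sum.cartesian_product)
  also have "\<dots> = (\<Sum>is\<in>(\<lambda>(is, i). i # is) ` (?L \<times> J). prod_list (map u is) * flag_sum \<omega> K is)"
    by (subst sum.reindex) (auto simp: inj_on_def case_prod_unfold)
  also have "(\<lambda>(is, i). i # is) ` (?L \<times> J) = {is. set is \<subseteq> J \<and> length is = Suc m}"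
    by (rule lists_length_Suc_eq[symmetric])
  finally show ?case .
qed

end

lemma exponents_count:
  assumes "set is \<subseteq> {1..n}" "length is = n"
  shows "count (mset is) \<in> exponents n"
proof -
  have "(\<Sum>i=1..n. count (mset is) i) = size (mset is)"
    unfolding size_multiset_overloaded_eq using assms
    by (intro sum.mono_neutral_right[symmetric] sum.mono_neutral_right) (auto simp: count_eq_zero_iff)
  then show ?thesis using assms by (auto simp: exponents_def count_eq_zero_iff)
qed

lemma exponents_list_ex:
  assumes c: "c \<in> exponents n"
  shows "\<exists>is. set is \<subseteq> {1..n} \<and> length is = n \<and> count (mset is) = c"
proof -
  define M where "M = (\<Sum>i=1..n. replicate_mset (c i) i)"
  have count: "count M i = c i" for i
  proof -
    have "count M i = (\<Sum>j=1..n. if j = i then c i else 0)"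
      unfolding M_def count_sum by (intro sum.cong) auto
    also have "\<dots> = c i" using c by (auto simp: exponents_def)
    finally show ?thesis .
  qed
  obtain "is" where "is": "mset is = M" using ex_mset by blast
  have "set is \<subseteq> {1..n}"
  proof
    fix i assume "i \<in> set is"
    then have "count M i \<noteq> 0" using "is" by (metis count_eq_zero_iff set_mset_mset)
    then show "i \<in> {1..n}" using c by (auto simp: exponents_def count)
  qed
  moreover have "length is = n"
  proof -
    have "length is = size M" using "is" by (metis size_mset)
    also have "\<dots> = n" using c by (simp add: M_def size_multiset_sum exponents_def)
    finally show ?thesis .
  qed
  ultimately show ?thesis using "is" count by (intro exI[of _ "is"]) auto
qed

lemma finite_exponents: "finite (exponents n)"
proof -
  have "exponents n \<subseteq> (\<lambda>is. count (mset is)) ` {is. set is \<subseteq> {1..n} \<and> length is = n}"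
    using exponents_list_ex by (fastforce simp: image_iff)
  then show ?thesis using finite_lists_length_eq[of "{1..n}" n] by (meson finite_surj finite_atLeastAtMost)
qed

lemma prod_list_count:
  fixes u :: "nat \<Rightarrow> real"
  assumes "set is \<subseteq> {1..n}"
  shows "prod_list (map u is) = (\<Prod>i=1..n. u i ^ count (mset is) i)"
  using assms
proof (induction "is")
  case (Cons i "is")
  have "(\<Prod>k=1..n. u k ^ count (mset (i # is)) k)
      = (\<Prod>k=1..n. (if k = i then u k else 1) * u k ^ count (mset is) k)"
    by (intro prod.cong) auto
  also have "\<dots> = u i * (\<Prod>k=1..n. u k ^ count (mset is) k)"
    using Cons.prems by (simp add: prod.distrib)
  finally show ?case using Cons by simp
qed simp

lemma card_lists_count:
  assumes c: "c \<in> exponents n"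
  shows "real (card {is. set is \<subseteq> {1..n} \<and> length is = n \<and> count (mset is) = c})
    = fact n / (\<Prod>i=1..n. fact (c i))"
proof -
  obtain js where js: "set js \<subseteq> {1..n}" "length js = n" "count (mset js) = c"
    using exponents_list_ex[OF c] by blast
  let ?M = "mset js"
  have "{is. set is \<subseteq> {1..n} \<and> length is = n \<and> count (mset is) = c} = permutations_of_multiset ?M"
  proof -
    have "count (mset is) = c \<longleftrightarrow> mset is = ?M" for "is" using js(3) by (metis multiset_eqI)
    moreover have "mset is = ?M \<Longrightarrow> set is \<subseteq> {1..n} \<and> length is = n" for "is"
      using js by (metis set_mset_mset size_mset)
    ultimately show ?thesis by (auto simp: permutations_of_multiset_def)
  qed
  moreover have "(\<Prod>i\<in>set_mset ?M. fact (count ?M i) :: nat) = (\<Prod>i=1..n. fact (c i))"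
  proof -
    have "count ?M i = 0" if "i \<notin> set js" for i
      using that by (metis count_eq_zero_iff set_mset_mset)
    then show ?thesis using js by (intro prod.mono_neutral_cong_left) auto
  qed
  moreover have "size ?M = n" using js by simp
  ultimately have "card {is. set is \<subseteq> {1..n} \<and> length is = n \<and> count (mset is) = c} * (\<Prod>i=1..n. fact (c i)) = fact n"
    using card_permutations_of_multiset_aux[of ?M] by simp
  then have "real (card {is. set is \<subseteq> {1..n} \<and> length is = n \<and> count (mset is) = c}) * (\<Prod>i=1..n. fact (c i)) = fact n"
    by (metis (mono_tags, lifting) of_nat_fact of_nat_mult of_nat_prod prod.cong)
  then show ?thesis by (simp add: field_simps)
qed

section \<open>Permutations and increasing trees\<close>

context indexed_basis
begin

lemma flag_sum_permutations:
  assumes "finite K" "length is = card K"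
  shows "flag_sum \<omega> K is
    = (\<Sum>js\<in>permutations_of_set K. \<Prod>k<length is. \<omega> (is ! k) \<bullet> dual (set (drop k js)) (js ! k))"
  using assms
proof (induction "is" arbitrary: K)
  case Nil
  then show ?case by simp
next
  case (Cons i "is")
  let ?f = "\<lambda>is js. \<Prod>k<length is. \<omega> (is ! k) \<bullet> dual (set (drop k js)) (js ! k)"
  let ?P = permutations_of_set
  have ne: "K \<noteq> {}" using Cons.prems by auto
  have cons: "?f (i # is) (j # js) = (\<omega> i \<bullet> dual K j) * ?f is js"
    if "j \<in> K" "js \<in> ?P (K - {j})" for j js
  proof -
    have "set (j # js) = K" using that permutations_of_setD[of js "K - {j}"] by auto
    then show ?thesis by (simp add: prod.lessThan_Suc_shift del: set_simps prod.lessThan_Suc)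
  qed
  have "(\<Sum>js\<in>?P K. ?f (i # is) js) = (\<Sum>j\<in>K. \<Sum>js\<in>(#) j ` ?P (K - {j}). ?f (i # is) js)"
    unfolding permutations_of_set_nonempty[OF ne]
    using Cons.prems(1) by (intro sum.UNION_disjoint) auto
  also have "\<dots> = (\<Sum>j\<in>K. \<Sum>js\<in>?P (K - {j}). ?f (i # is) (j # js))"
    by (rule sum.cong[OF refl]) (subst sum.reindex, simp_all add: inj_on_def del: prod.lessThan_Suc)
  also have "\<dots> = (\<Sum>j\<in>K. \<Sum>js\<in>?P (K - {j}). (\<omega> i \<bullet> dual K j) * ?f is js)"
    by (intro sum.cong refl cons)
  also have "\<dots> = (\<Sum>j\<in>K. (\<omega> i \<bullet> dual K j) * flag_sum \<omega> (K - {j}) is)"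
  proof (rule sum.cong[OF refl])
    fix j assume "j \<in> K"
    then have "finite (K - {j})" "length is = card (K - {j})" using Cons.prems by auto
    then show "(\<Sum>js\<in>?P (K - {j}). (\<omega> i \<bullet> dual K j) * ?f is js)
        = (\<omega> i \<bullet> dual K j) * flag_sum \<omega> (K - {j}) is"
      by (simp only: Cons.IH sum_distrib_left)
  qed
  finally show ?case by simp
qed

end

lemma bij_betw_permutes_permutations_of_set:
  "bij_betw (\<lambda>v. map (inv v) [1..<Suc n]) {v. v permutes {1..n}} (permutations_of_set {1..n})"
proof -
  let ?\<phi> = "\<lambda>v :: nat \<Rightarrow> nat. map (inv v) [1..<Suc n]"
  have inj: "inj_on ?\<phi> {v. v permutes {1..n}}"
  proof (rule inj_onI)
    fix v w :: "nat \<Rightarrow> nat"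
    assume "v \<in> {v. v permutes {1..n}}" "w \<in> {v. v permutes {1..n}}" and eq: "?\<phi> v = ?\<phi> w"
    then have v: "v permutes {1..n}" and w: "w permutes {1..n}" by auto
    have "inv v k = inv w k" for k
    proof (cases "k \<in> {1..n}")
      case True
      then show ?thesis using eq by (auto simp: map_eq_conv)
    next
      case False
      then show ?thesis
        using permutes_not_in[OF permutes_inv[OF v]] permutes_not_in[OF permutes_inv[OF w]] by simp
    qed
    then have "inv v = inv w" by blast
    then show "v = w" using permutes_inv_inv v w by metis
  qed
  have sub: "?\<phi> ` {v. v permutes {1..n}} \<subseteq> permutations_of_set {1..n}"
  proof clarify
    fix v :: "nat \<Rightarrow> nat" assume v: "v permutes {1..n}"
    then have "inv v permutes {1..n}" by (rule permutes_inv)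
    then have "inv v ` {1..n} = {1..n}" "inj (inv v)" by (auto simp: permutes_image permutes_inj)
    then show "?\<phi> v \<in> permutations_of_set {1..n}"
      by (intro permutations_of_setI) (auto simp: distinct_map atLeastLessThanSuc_atLeastAtMost inj_on_def
          simp del: upt_Suc)
  qed
  have "card (?\<phi> ` {v. v permutes {1..n}}) = card (permutations_of_set {1..n})"
    unfolding card_image[OF inj] using card_permutations[of "{1..n}" n] by simp
  then have "?\<phi> ` {v. v permutes {1..n}} = permutations_of_set {1..n}"
    by (intro card_subset_eq sub) simp_all
  then show ?thesis using inj by (simp add: bij_betw_def)
qed

context indexed_basis
begin

lemma flag_sum_permutes:
  "flag_sum \<omega> {1..n} (map ii [1..<Suc n])
    = (\<Sum>v | v permutes {1..n}. \<Prod>j=1..n. \<omega> (ii (v j)) \<bullet> dual {l \<in> {1..n}. v j \<le> v l} j)"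
proof -
  let ?\<phi> = "\<lambda>v :: nat \<Rightarrow> nat. map (inv v) [1..<Suc n]"
  let ?is = "map ii [1..<Suc n]"
  have "flag_sum \<omega> {1..n} ?is = (\<Sum>js\<in>permutations_of_set {1..n}.
      \<Prod>k<length ?is. \<omega> (?is ! k) \<bullet> dual (set (drop k js)) (js ! k))"
    by (rule flag_sum_permutations) auto
  also have "\<dots> = (\<Sum>v | v permutes {1..n}.
      \<Prod>k<length ?is. \<omega> (?is ! k) \<bullet> dual (set (drop k (?\<phi> v))) (?\<phi> v ! k))"
    by (rule sum.reindex_bij_betw[OF bij_betw_permutes_permutations_of_set, symmetric])
  also have "\<dots> = (\<Sum>v | v permutes {1..n}. \<Prod>j=1..n. \<omega> (ii (v j)) \<bullet> dual {l \<in> {1..n}. v j \<le> v l} j)"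
  proof (intro sum.cong refl)
    fix v assume "v \<in> {v. v permutes {1..n}}"
    then have v: "v permutes {1..n}" by simp
    have inv: "v (inv v k) = k" "inv v (v k) = k" for k using permutes_inverses[OF v] by auto
    have v_in: "v j \<in> {1..n} \<longleftrightarrow> j \<in> {1..n}" for j using permutes_in_image[OF v] by simp
    have inv_in: "inv v j \<in> {1..n} \<longleftrightarrow> j \<in> {1..n}" for j
      using permutes_in_image[OF permutes_inv[OF v]] by simp
    show "(\<Prod>k<length ?is. \<omega> (?is ! k) \<bullet> dual (set (drop k (?\<phi> v))) (?\<phi> v ! k))
        = (\<Prod>j=1..n. \<omega> (ii (v j)) \<bullet> dual {l \<in> {1..n}. v j \<le> v l} j)"
    proof (rule prod.reindex_bij_witness[of _ "\<lambda>j. v j - 1" "\<lambda>k. inv v (Suc k)"])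
      fix k assume k: "k \<in> {..<length ?is}"
      then have k': "k < n" by (simp del: upt_Suc)
      show "inv v (Suc k) \<in> {1..n}" using k' inv_in[of "Suc k"] by simp
      show "v (inv v (Suc k)) - 1 = k" by (simp add: inv)
      have "set (drop k (?\<phi> v)) = inv v ` {Suc k..n}"
        by (simp add: drop_map atLeastLessThanSuc_atLeastAtMost del: upt_Suc)
      also have "\<dots> = {l \<in> {1..n}. Suc k \<le> v l}"
      proof (intro subset_antisym subsetI)
        fix l assume "l \<in> inv v ` {Suc k..n}"
        then obtain m where "m \<in> {Suc k..n}" "l = inv v m" by blast
        then show "l \<in> {l \<in> {1..n}. Suc k \<le> v l}" using inv_in[of m] by (simp add: inv)
      next
        fix l assume "l \<in> {l \<in> {1..n}. Suc k \<le> v l}"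
        then have "v l \<in> {Suc k..n}" "l = inv v (v l)" using v_in[of l] by (auto simp: inv)
        then show "l \<in> inv v ` {Suc k..n}" by blast
      qed
      finally have "set (drop k (?\<phi> v)) = {l \<in> {1..n}. Suc k \<le> v l}" .
      then show "\<omega> (ii (v (inv v (Suc k)))) \<bullet> dual {l \<in> {1..n}. v (inv v (Suc k)) \<le> v l} (inv v (Suc k))
          = \<omega> (?is ! k) \<bullet> dual (set (drop k (?\<phi> v))) (?\<phi> v ! k)"
        using k' by (simp add: inv del: upt_Suc)
    next
      fix j assume j: "j \<in> {1..n}"
      then have "v j \<in> {1..n}" using v_in by simp
      then show "inv v (Suc (v j - 1)) = j" "v j - 1 \<in> {..<length ?is}"
        by (auto simp: inv)
    qed
  qed
  finally show ?thesis .
qed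

lemma dual_component:
  assumes K: "K \<subseteq> N" and D: "D \<subseteq> K" "j \<in> D"
    and orth: "\<And>a b. a \<in> D \<Longrightarrow> b \<in> K - D \<Longrightarrow> \<alpha> a \<bullet> \<alpha> b = 0"
  shows "dual K j = dual D j"
proof (rule dual_eqI[OF K])
  have DN: "D \<subseteq> N" using K D by blast
  have "span (\<alpha> ` D) \<subseteq> span (\<alpha> ` K)" using D by (intro span_mono) auto
  then show "dual D j \<in> span (\<alpha> ` K)" using dual_span[OF DN D(2)] by blast
  fix k assume k: "k \<in> K"
  show "dual D j \<bullet> \<alpha> k = (if k = j then 1 else 0)"
  proof (cases "k \<in> D")
    case True
    then show ?thesis using dual_inner[OF DN D(2)] by simp
  next
    case False
    have "dual D j \<bullet> \<alpha> k = (\<Sum>d\<in>D. (dual D j \<bullet> dual D d) * (\<alpha> d \<bullet> \<alpha> k))"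
      by (subst dual_expansion[OF DN dual_span[OF DN D(2)]]) (simp add: inner_sum_left)
    also have "\<dots> = 0" using orth k False by (intro sum.neutral) auto
    finally show ?thesis using False D by auto
  qed
qed (use D in auto)

lemma fund_weight_inner_dual:
  assumes D: "D \<subseteq> N" "j \<in> D" and i: "i \<in> N"
  shows "fund_weight \<alpha> N i \<bullet> dual D j
    = (if i \<in> D then 2 / (\<alpha> j \<bullet> \<alpha> j) * (fund_weight \<alpha> D i \<bullet> fund_weight \<alpha> D j) else 0)"
proof -
  have expand: "z \<bullet> dual D j = (\<Sum>d\<in>D. (dual D j \<bullet> dual D d) * (z \<bullet> \<alpha> d))" for z
    by (subst dual_expansion[OF D(1) dual_span[OF D]]) (simp add: inner_sum_right)
  show ?thesis
  proof (cases "i \<in> D")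
    case True
    have "fund_weight \<alpha> N i \<bullet> \<alpha> d = fund_weight \<alpha> D i \<bullet> \<alpha> d" if "d \<in> D" for d
      using that D i True dual_inner[of N i d] dual_inner[of D i d] by (auto simp: fund_weight_eq)
    then have "fund_weight \<alpha> N i \<bullet> dual D j = fund_weight \<alpha> D i \<bullet> dual D j"
      by (simp add: expand cong: sum.cong)
    moreover have "\<alpha> j \<bullet> \<alpha> j \<noteq> 0" using simple_nonzero[of j] D by auto
    ultimately show ?thesis using True by (simp add: fund_weight_eq[OF D])
  next
    case False
    have "fund_weight \<alpha> N i \<bullet> \<alpha> d = 0" if "d \<in> D" for d
    proof -
      have "d \<in> N" "d \<noteq> i" using that D False by auto
      then show ?thesis using i by (simp add: fund_weight_eq dual_inner)
    qed
    then show ?thesis using False by (simp add: expand cong: sum.cong)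
  qed
qed

end

lemma sym_dynkin_edges: "(i, j) \<in> dynkin_edges \<alpha> n \<Longrightarrow> (j, i) \<in> dynkin_edges \<alpha> n"
  by (auto simp: dynkin_edges_def inner_commute)

lemma induced_connected_Un:
  assumes sym: "\<And>i j. (i, j) \<in> E \<Longrightarrow> (j, i) \<in> E"
    and A: "induced_connected E A" and B: "induced_connected E B"
    and ab: "a \<in> A" "b \<in> B" "(a, b) \<in> E"
  shows "induced_connected E (A \<union> B)"
proof -
  let ?R = "(E \<inter> (A \<union> B) \<times> (A \<union> B))\<^sup>*"
  have subA: "(E \<inter> A \<times> A)\<^sup>* \<subseteq> ?R" and subB: "(E \<inter> B \<times> B)\<^sup>* \<subseteq> ?R"
    by (rule rtrancl_mono, fast)+
  have sym_R: "(j, i) \<in> ?R" if "(i, j) \<in> ?R" for i j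
    by (rule symD[OF sym_rtrancl that]) (auto simp: sym_def intro: sym)
  have "(a, b) \<in> ?R" using ab by auto
  have "(i, a) \<in> ?R" if "i \<in> A \<union> B" for i
  proof (cases "i \<in> A")
    case True
    then have "(i, a) \<in> (E \<inter> A \<times> A)\<^sup>*" using A ab by (simp add: induced_connected_def)
    then show ?thesis using subA by blast
  next
    case False
    then have "(i, b) \<in> (E \<inter> B \<times> B)\<^sup>*" using B ab that by (simp add: induced_connected_def)
    then show ?thesis using subB sym_R[OF \<open>(a, b) \<in> ?R\<close>] by (meson rtrancl_trans subsetD)
  qed
  then show ?thesis unfolding induced_connected_def using sym_R by (meson rtrancl_trans)
qed

locale dynkin_labelling =
  fixes \<alpha> :: "nat \<Rightarrow> 'a::euclidean_space" and n :: nat and v :: "nat \<Rightarrow> nat"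
  assumes permutes: "v permutes {1..n}"
begin

abbreviation E :: "(nat \<times> nat) set" where
  "E \<equiv> dynkin_edges \<alpha> n"

definition above :: "nat \<Rightarrow> nat set" where
  "above j = {l \<in> {1..n}. v j \<le> v l}"

definition component :: "nat \<Rightarrow> nat set" where
  "component j = {i. (i, j) \<in> (E \<inter> above j \<times> above j)\<^sup>*}"

text \<open>The only tree that \<open>v\<close> makes an increasing \<open>\<Phi>\<close>-tree.\<close>

definition tree :: "(nat \<times> nat) set" where
  "tree = {(i, p). i \<in> {1..n} \<and> p \<in> {1..n} \<and> i \<noteq> p \<and> i \<in> component p \<and>
     (\<forall>q\<in>{1..n}. i \<in> component q \<and> q \<noteq> i \<longrightarrow> p \<in> component q)}"

lemma v_eq_iff: "v i = v j \<longleftrightarrow> i = j"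
  using permutes_inj[OF permutes] by (auto dest: injD)

lemma sym_induced: "(i, j) \<in> (E \<inter> K \<times> K)\<^sup>* \<Longrightarrow> (j, i) \<in> (E \<inter> K \<times> K)\<^sup>*"
  by (rule symD[OF sym_rtrancl]) (auto simp: sym_def dest: sym_dynkin_edges)

lemma component_self: "j \<in> component j"
  by (simp add: component_def)

lemma component_above:
  assumes "j \<in> {1..n}" "i \<in> component j"
  shows "i \<in> above j"
proof -
  have "(i, j) \<in> (E \<inter> above j \<times> above j)\<^sup>*" using assms by (simp add: component_def)
  then show ?thesis using assms(1) by (cases rule: converse_rtranclE) (auto simp: above_def)
qed

lemma component_in: "j \<in> {1..n} \<Longrightarrow> i \<in> component j \<Longrightarrow> i \<in> {1..n} \<and> v j \<le> v i"
  using component_above[of j i] by (simp add: above_def)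

lemma above_mono: "v q \<le> v p \<Longrightarrow> (E \<inter> above p \<times> above p)\<^sup>* \<subseteq> (E \<inter> above q \<times> above q)\<^sup>*"
  by (rule rtrancl_mono) (auto simp: above_def)

lemma component_subset:
  assumes "j \<in> {1..n}" "i \<in> component j"
  shows "component i \<subseteq> component j"
proof
  fix k assume "k \<in> component i"
  then have "(k, i) \<in> (E \<inter> above j \<times> above j)\<^sup>*"
    using above_mono[of j i] component_in[OF assms] by (auto simp: component_def)
  then show "k \<in> component j" using assms(2) by (auto simp: component_def)
qed

lemma component_meet:
  assumes "i \<in> component p" "i \<in> component q" "v q \<le> v p"
  shows "p \<in> component q"
proof -
  have "(i, p) \<in> (E \<inter> above q \<times> above q)\<^sup>*"
    using assms(1) subsetD[OF above_mono[OF assms(3)]] by (simp add: component_def)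
  then have "(p, i) \<in> (E \<inter> above q \<times> above q)\<^sup>*" by (rule sym_induced)
  then show ?thesis using assms(2) by (auto simp: component_def)
qed

lemma component_connected: "induced_connected E (component j)"
proof -
  let ?C = "component j"
  have to_j: "(i, j) \<in> (E \<inter> ?C \<times> ?C)\<^sup>*" if "i \<in> ?C" for i
  proof -
    have "(i, j) \<in> (E \<inter> above j \<times> above j)\<^sup>*" using that by (simp add: component_def)
    then show ?thesis
    proof (induction rule: converse_rtrancl_induct)
      case (step a b)
      then have "a \<in> ?C" "b \<in> ?C" by (auto simp: component_def intro: converse_rtrancl_into_rtrancl)
      then have "(a, b) \<in> E \<inter> ?C \<times> ?C" using step by blast
      then show ?case using step.IH by (rule converse_rtrancl_into_rtrancl)
    qed simp
  qed
  then show ?thesis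
    unfolding induced_connected_def using sym_induced[of _ _ ?C] by (meson rtrancl_trans)
qed

lemma connected_subset_component:
  assumes "induced_connected E I" "j \<in> I" "I \<subseteq> above j"
  shows "I \<subseteq> component j"
proof
  fix i assume "i \<in> I"
  then have "(i, j) \<in> (E \<inter> I \<times> I)\<^sup>*" using assms by (simp add: induced_connected_def)
  moreover have "(E \<inter> I \<times> I)\<^sup>* \<subseteq> (E \<inter> above j \<times> above j)\<^sup>*"
    using assms(3) by (intro rtrancl_mono) blast
  ultimately show "i \<in> component j" by (auto simp: component_def)
qed

lemma component_closed:
  assumes "a \<in> component j" "b \<in> above j - component j" "j \<in> {1..n}"
  shows "\<alpha> a \<bullet> \<alpha> b = 0"
proof (rule ccontr)
  assume "\<alpha> a \<bullet> \<alpha> b \<noteq> 0"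
  moreover have "a \<in> above j" using component_above assms by blast
  moreover have "a \<noteq> b" using assms by blast
  ultimately have "(b, a) \<in> E \<inter> above j \<times> above j"
    using assms(2) by (auto simp: dynkin_edges_def above_def inner_commute)
  then have "b \<in> component j"
    using assms(1) by (auto simp: component_def intro: converse_rtrancl_into_rtrancl)
  then show False using assms(2) by blast
qed

lemma rooted_tree_single_valued: "rooted_tree {1..n} T \<Longrightarrow> single_valued T"
  unfolding rooted_tree_def single_valued_def by (metis DiffI SigmaD1 singletonD subsetD)

lemma rooted_tree_irrefl:
  assumes T: "rooted_tree {1..n} T"
  shows "(i, i) \<notin> T"
proof
  assume i: "(i, i) \<in> T"
  obtain r where r: "\<And>p. (r, p) \<notin> T" "\<And>i. i \<in> {1..n} \<Longrightarrow> (i, r) \<in> T\<^sup>*"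
    using T unfolding rooted_tree_def by blast
  have "x = i" if "(i, x) \<in> T\<^sup>*" for x
    using that
    by (induction rule: rtrancl_induct)
      (use i rooted_tree_single_valued[OF T] in \<open>auto simp: single_valued_def\<close>)
  moreover have "i \<in> {1..n}" using i T by (auto simp: rooted_tree_def)
  ultimately show False using r i by metis
qed

lemma desc_eq_component:
  assumes T: "increasing_Phi_tree \<alpha> n T v" and j: "j \<in> {1..n}"
  shows "desc j T = component j"
proof
  have tree: "rooted_tree {1..n} T"
    and conn: "\<And>i. i \<in> {1..n} \<Longrightarrow> induced_connected E (desc i T)"
    and T2: "\<And>i j. i \<in> {1..n} \<Longrightarrow> j \<in> {1..n} \<Longrightarrow> i \<noteq> j \<Longrightarrow> desc i T \<inter> desc j T = {} \<Longrightarrow>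
      \<not> induced_connected E (desc i T \<union> desc j T)"
    and incr: "\<And>i j. i \<in> {1..n} \<Longrightarrow> j \<in> {1..n} \<Longrightarrow> i \<in> desc j T \<Longrightarrow> v j \<le> v i"
    using T unfolding increasing_Phi_tree_def Phi_tree_def by blast+
  have desc_in: "i \<in> {1..n}" if "i \<in> desc j T" for i
  proof -
    have "(i, j) \<in> T\<^sup>*" using that by (simp add: desc_def)
    then show ?thesis
      using j tree by (cases rule: converse_rtranclE) (auto simp: rooted_tree_def)
  qed
  show "desc j T \<subseteq> component j"
    using conn[OF j] incr[OF _ j] desc_in
    by (intro connected_subset_component) (auto simp: above_def desc_def)
  show "component j \<subseteq> desc j T"
  proof
    fix i assume "i \<in> component j"
    then have "(i, j) \<in> (E \<inter> above j \<times> above j)\<^sup>*" by (simp add: component_def)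
    then show "i \<in> desc j T"
    proof (induction rule: converse_rtrancl_induct)
      case base
      show ?case by (simp add: desc_def)
    next
      case (step b a)
      show ?case
      proof (rule ccontr)
        assume b: "b \<notin> desc j T"
        have bn: "b \<in> {1..n}" "v j \<le> v b" using step by (auto simp: above_def)
        have "j \<notin> desc b T"
        proof
          assume "j \<in> desc b T"
          then have "v b \<le> v j" using incr j bn by blast
          then have "b = j" using bn v_eq_iff by (metis antisym)
          then show False using b by (simp add: desc_def)
        qed
        then have "desc b T \<inter> desc j T = {}"
          using b single_valued_confluent[OF rooted_tree_single_valued[OF tree]]
          by (fastforce simp: desc_def)
        moreover have "induced_connected E (desc b T \<union> desc j T)"
          using step.IH step.hyps(1) bn(1)
          by (intro induced_connected_Un[OF _ conn conn[OF j], of b b a])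
            (auto simp: desc_def intro: sym_dynkin_edges)
        moreover have "b \<noteq> j" using b by (auto simp: desc_def)
        ultimately show False using T2 bn j by blast
      qed
    qed
  qed
qed

lemma increasing_tree_unique:
  assumes T: "increasing_Phi_tree \<alpha> n T v"
  shows "T = tree"
proof -
  have rt: "rooted_tree {1..n} T" using T by (simp add: increasing_Phi_tree_def Phi_tree_def)
  then have TN: "T \<subseteq> {1..n} \<times> {1..n}" by (simp add: rooted_tree_def)
  have sv: "single_valued T" using rooted_tree_single_valued[OF rt] .
  have desc: "(i, j) \<in> T\<^sup>* \<longleftrightarrow> i \<in> component j" if "j \<in> {1..n}" for i j
    using desc_eq_component[OF T that] by (auto simp: desc_def)
  have first: "\<exists>p. (i, p) \<in> T \<and> (p, q) \<in> T\<^sup>*" if "(i, q) \<in> T\<^sup>*" "i \<noteq> q" for i q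
    using that by (metis converse_rtranclE)
  have "(i, p) \<in> T \<longleftrightarrow> (i, p) \<in> tree" for i p
  proof
    assume ip: "(i, p) \<in> T"
    then have N: "i \<in> {1..n}" "p \<in> {1..n}" using TN by auto
    have "i \<noteq> p" using ip rooted_tree_irrefl[OF rt] by blast
    moreover have "i \<in> component p" using ip desc N by blast
    moreover have "p \<in> component q" if q: "q \<in> {1..n}" "i \<in> component q" "q \<noteq> i" for q
    proof -
      obtain p' where p': "(i, p') \<in> T" "(p', q) \<in> T\<^sup>*" using first[of i q] desc q by blast
      then have "p' = p" using sv ip by (auto simp: single_valued_def)
      then show ?thesis using p' desc q by blast
    qed
    ultimately show "(i, p) \<in> tree" using N by (auto simp: tree_def)
  next
    assume ip: "(i, p) \<in> tree"
    then have N: "i \<in> {1..n}" "p \<in> {1..n}" "i \<noteq> p" "i \<in> component p"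
      and min: "\<And>q. q \<in> {1..n} \<Longrightarrow> i \<in> component q \<Longrightarrow> q \<noteq> i \<Longrightarrow> p \<in> component q"
      by (auto simp: tree_def)
    obtain p' where p': "(i, p') \<in> T" "(p', p) \<in> T\<^sup>*" using first[of i p] desc N by blast
    have p'N: "p' \<in> {1..n}" using p' TN by auto
    have "p \<in> component p'"
      using p' p'N desc rooted_tree_irrefl[OF rt] by (intro min) auto
    moreover have "p' \<in> component p" using p' desc N by blast
    ultimately have "v p = v p'" using component_in N p'N by (metis antisym)
    then show "(i, p) \<in> T" using p' v_eq_iff by simp
  qed
  then show ?thesis by auto
qed

lemma tree_increasing:
  assumes conn: "induced_connected E {1..n}" and n: "1 \<le> n"
  shows "increasing_Phi_tree \<alpha> n tree v"
proof -
  define r where "r = inv v 1"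
  have vr: "v r = 1" using permutes_inverses[OF permutes] by (simp add: r_def)
  have rN: "r \<in> {1..n}" using permutes_in_image[OF permutes, of r] vr n by simp
  have v_pos: "1 \<le> v i" if "i \<in> {1..n}" for i
    using permutes_in_image[OF permutes, of i] that by simp
  have comp_r: "{1..n} \<subseteq> component r"
    using rN vr v_pos by (intro connected_subset_component[OF conn]) (auto simp: above_def)
  have root: "q = r" if "r \<in> component q" "q \<in> {1..n}" for q
    using component_in[OF that(2,1)] vr v_pos[OF that(2)] v_eq_iff by (metis antisym)
  have parent: "\<exists>p. (i, p) \<in> tree" if i: "i \<in> {1..n}" "i \<noteq> r" for i
  proof -
    define Q where "Q = {q \<in> {1..n}. q \<noteq> i \<and> i \<in> component q}"
    have "finite (v ` Q)" "r \<in> Q" using comp_r i rN by (auto simp: Q_def)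
    then have "Max (v ` Q) \<in> v ` Q" by (intro Max_in) auto
    then obtain p where p: "p \<in> Q" "v p = Max (v ` Q)" by auto
    have "v q \<le> v p" if "q \<in> Q" for q using p \<open>finite (v ` Q)\<close> that by simp
    then have "p \<in> component q" if "q \<in> Q" for q
      using component_meet[of i p q] p that by (auto simp: Q_def)
    then show ?thesis using p i by (intro exI[of _ p]) (auto simp: tree_def Q_def)
  qed
  have unique: "p = q" if "(i, p) \<in> tree" "(i, q) \<in> tree" for i p q
  proof -
    have "p \<in> component q" "q \<in> component p" "p \<in> {1..n}" "q \<in> {1..n}"
      using that by (auto simp: tree_def)
    then have "v p = v q" using component_in by (metis antisym)
    then show ?thesis by (simp add: v_eq_iff)
  qed
  have reach: "(i, q) \<in> tree\<^sup>* \<longleftrightarrow> i \<in> component q" if q: "q \<in> {1..n}" for i q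
  proof
    assume "(i, q) \<in> tree\<^sup>*"
    then show "i \<in> component q"
    proof (induction rule: converse_rtrancl_induct)
      case (step a b)
      then show ?case using component_subset[OF q] by (auto simp: tree_def)
    qed (rule component_self)
  next
    show "(i, q) \<in> tree\<^sup>*" if "i \<in> component q"
      using that
    proof (induction "v i" arbitrary: i rule: less_induct)
      case less
      show ?case
      proof (cases "i = q")
        case False
        have i: "i \<in> {1..n}" using component_in[OF q less.prems] by blast
        have "i \<noteq> r" using root less.prems q False by blast
        then obtain p where p: "(i, p) \<in> tree" using parent i by blast
        then have "i \<in> component p" "p \<in> {1..n}" "i \<noteq> p" by (auto simp: tree_def)
        then have "v p < v i" using component_in[of p i] v_eq_iff[of i p] by auto
        moreover have "p \<in> component q" using p q less.prems False by (auto simp: tree_def)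
        ultimately have "(p, q) \<in> tree\<^sup>*" by (rule less.hyps)
        then show ?thesis using p by (rule converse_rtrancl_into_rtrancl[rotated])
      qed simp
    qed
  qed
  then have desc: "desc j tree = component j" if "j \<in> {1..n}" for j
    using that by (auto simp: desc_def)
  have "rooted_tree {1..n} tree"
    unfolding rooted_tree_def
  proof (intro conjI bexI[OF _ rN] allI ballI)
    show "tree \<subseteq> {1..n} \<times> {1..n}" by (auto simp: tree_def)
    show "(r, p) \<notin> tree" for p using root by (auto simp: tree_def)
    show "\<exists>!p. (i, p) \<in> tree" if "i \<in> {1..n} - {r}" for i
      using parent[of i] unique that by blast
    show "(i, r) \<in> tree\<^sup>*" if "i \<in> {1..n}" for i using reach[OF rN] comp_r that by blast
  qed
  moreover have "\<not> induced_connected E (component i \<union> component j)"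
    if ij: "i \<in> {1..n}" "j \<in> {1..n}" "component i \<inter> component j = {}" "v i \<le> v j" for i j
  proof
    assume "induced_connected E (component i \<union> component j)"
    moreover have "component i \<union> component j \<subseteq> above i"
      using component_in[OF ij(1)] component_in[OF ij(2)] order_trans[OF ij(4)]
      by (auto simp: above_def)
    ultimately have "component i \<union> component j \<subseteq> component i"
      using component_self[of i] by (intro connected_subset_component) auto
    then show False using ij(3) component_self[of j] by blast
  qed
  then have "\<not> induced_connected E (component i \<union> component j)"
    if "i \<in> {1..n}" "j \<in> {1..n}" "component i \<inter> component j = {}" for i j
    using that by (metis Int_commute Un_commute nle_le)
  ultimately have Phi: "Phi_tree \<alpha> n tree"
    unfolding Phi_tree_def using desc component_connected by auto
  show ?thesis
    unfolding increasing_Phi_tree_def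
  proof (intro conjI ballI impI)
    fix i j assume "i \<in> {1..n}" "j \<in> {1..n}" "i \<in> desc j tree"
    then show "v j \<le> v i" using desc[of j] component_in[of j i] by simp
  qed (rule Phi, rule permutes)
qed

end

context root_basis
begin

definition eulerian_coeff :: "(nat \<Rightarrow> nat) \<Rightarrow> real" where
  "eulerian_coeff c = real (card (weyl_group \<Phi>)) * flag_sum (fund_weight \<alpha> {1..n}) {1..n}
     (SOME is. set is \<subseteq> {1..n} \<and> length is = n \<and> count (mset is) = c)"

lemma eulerian_coeff_eq:
  assumes "is": "set is \<subseteq> {1..n}" "length is = n" "count (mset is) = c"
  shows "eulerian_coeff c
    = real (card (weyl_group \<Phi>)) * flag_sum (fund_weight \<alpha> {1..n}) {1..n} is"
proof -
  define js where "js = (SOME is. set is \<subseteq> {1..n} \<and> length is = n \<and> count (mset is) = c)"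
  have "set js \<subseteq> {1..n} \<and> length js = n \<and> count (mset js) = c"
    unfolding js_def by (rule someI[of _ "is"]) (use "is" in simp)
  then have "mset js = mset is" using "is"(3) by (metis multiset_eqI)
  then have "flag_sum (fund_weight \<alpha> {1..n}) {1..n} js = flag_sum (fund_weight \<alpha> {1..n}) {1..n} is"
    by (rule flag_sum_mset) simp
  then show ?thesis unfolding eulerian_coeff_def js_def[symmetric] by simp
qed

lemma dominant_weight:
  assumes "\<forall>i\<in>{1..n}. 0 \<le> u i"
  shows "dominant (\<Sum>i=1..n. u i *\<^sub>R fund_weight \<alpha> {1..n} i)"
  unfolding dominant_def inner_sum_left
proof (intro ballI sum_nonneg)
  fix i j assume "i \<in> {1..n}" "j \<in> {1..n}"
  then have "0 \<le> fund_weight \<alpha> {1..n} j \<bullet> \<alpha> i" by (simp add: fund_weight_eq dual_inner)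
  then show "0 \<le> u j *\<^sub>R fund_weight \<alpha> {1..n} j \<bullet> \<alpha> i" using assms \<open>j \<in> {1..n}\<close> by simp
qed

lemma vol_fun_expansion:
  assumes u: "\<forall>i\<in>{1..n}. 0 \<le> u i"
  shows "vol_fun \<Phi> n \<alpha> u
    = (\<Sum>c\<in>exponents n. eulerian_coeff c * (\<Prod>i=1..n. u i ^ c i / fact (c i)))"
proof -
  let ?\<omega> = "fund_weight \<alpha> {1..n}"
  let ?W = "real (card (weyl_group \<Phi>))"
  let ?L = "{is. set is \<subseteq> {1..n} \<and> length is = n}"
  let ?F = "\<lambda>is. prod_list (map u is) * flag_sum ?\<omega> {1..n} is"
  define G where "G = (\<lambda>c. \<Sum>is\<in>{is. is \<in> ?L \<and> count (mset is) = c}. ?F is)"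
  have L: "finite ?L" using finite_lists_length_eq[of "{1..n}" n] by simp
  have "vol_fun \<Phi> n \<alpha> u = ?W * cell_vol n {1..n} (\<Sum>i=1..n. u i *\<^sub>R ?\<omega> i)"
    unfolding vol_fun_def by (rule normalized_vol_weight_polytope[OF dominant_weight[OF u]])
  also have "cell_vol n {1..n} (\<Sum>i=1..n. u i *\<^sub>R ?\<omega> i) = (\<Sum>is\<in>?L. ?F is) / fact n"
    using cell_vol_flag_sum[of "{1..n}" _ u ?\<omega> n "{1..n}", OF _ refl] by (simp add: field_simps)
  also have "(\<Sum>is\<in>?L. ?F is) = (\<Sum>c\<in>exponents n. G c)"
    unfolding G_def using exponents_count by (intro sum.group[OF L finite_exponents, symmetric]) auto
  also have "?W * ((\<Sum>c\<in>exponents n. G c) / fact n) = (\<Sum>c\<in>exponents n. ?W * G c / fact n)"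
    by (simp add: sum_distrib_left sum_divide_distrib)
  also have "\<dots> = (\<Sum>c\<in>exponents n. eulerian_coeff c * (\<Prod>i=1..n. u i ^ c i / fact (c i)))"
  proof (rule sum.cong[OF refl])
    fix c assume c: "c \<in> exponents n"
    let ?Lc = "{is. is \<in> ?L \<and> count (mset is) = c}"
    have "?W * ?F is = eulerian_coeff c * (\<Prod>i=1..n. u i ^ c i)" if "is \<in> ?Lc" for "is"
      using that eulerian_coeff_eq[of "is" c] prod_list_count[of "is" n u] by simp
    then have "?W * G c = (\<Sum>is\<in>?Lc. eulerian_coeff c * (\<Prod>i=1..n. u i ^ c i))"
      unfolding G_def sum_distrib_left by (rule sum.cong[OF refl])
    also have "\<dots> = real (card ?Lc) * (eulerian_coeff c * (\<Prod>i=1..n. u i ^ c i))"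
      by (rule sum_constant)
    also have "real (card ?Lc) = fact n / (\<Prod>i=1..n. fact (c i))"
      using card_lists_count[OF c] by (simp only: mem_Collect_eq conj_assoc)
    finally show "?W * G c / fact n = eulerian_coeff c * (\<Prod>i=1..n. u i ^ c i / fact (c i))"
      by (simp add: prod_dividef)
  qed
  finally show ?thesis .
qed

lemma mixed_eulerian_eq_coeff:
  assumes c: "c \<in> exponents n"
  shows "mixed_eulerian \<Phi> n \<alpha> c = eulerian_coeff c"
proof -
  have "mixed_eulerian \<Phi> n \<alpha> = (\<lambda>c. if c \<in> exponents n then eulerian_coeff c else 0)"
    unfolding mixed_eulerian_def
  proof (rule the_equality, intro conjI allI impI)
    fix A :: "(nat \<Rightarrow> nat) \<Rightarrow> real"
    assume "(\<forall>c. c \<notin> exponents n \<longrightarrow> A c = 0) \<and> (\<forall>u. (\<forall>i\<in>{1..n}. 0 \<le> u i) \<longrightarrow>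
      vol_fun \<Phi> n \<alpha> u = (\<Sum>c\<in>exponents n. A c * (\<Prod>i=1..n. u i ^ c i / fact (c i))))"
    then have off: "\<And>c. c \<notin> exponents n \<Longrightarrow> A c = 0"
      and A: "\<And>u. \<forall>i\<in>{1..n}. 0 \<le> u i \<Longrightarrow>
        vol_fun \<Phi> n \<alpha> u = (\<Sum>c\<in>exponents n. A c * (\<Prod>i=1..n. u i ^ c i / fact (c i)))"
      by blast+
    have "A c = eulerian_coeff c" if c: "c \<in> exponents n" for c
    proof -
      let ?D = "\<lambda>c. (A c - eulerian_coeff c) / (\<Prod>i=1..n. fact (c i))"
      have "?D c = 0"
      proof (rule monomials_independent[OF _ finite_exponents _ _ c])
        fix a b :: "nat \<Rightarrow> nat"
        assume ab: "a \<in> exponents n" "b \<in> exponents n" "\<And>i. i \<in> {1..n} \<Longrightarrow> a i = b i"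
        have "a i = b i" for i
        proof (cases "i \<in> {1..n}")
          case False
          then have "a i = 0" "b i = 0" using ab(1,2) unfolding exponents_def by blast+
          then show ?thesis by simp
        qed (rule ab(3))
        then show "a = b" by blast
      next
        fix u :: "nat \<Rightarrow> real" assume "\<And>i. i \<in> {1..n} \<Longrightarrow> 0 \<le> u i"
        then have u: "\<forall>i\<in>{1..n}. 0 \<le> u i" by blast
        have "(\<Sum>c\<in>exponents n. ?D c * (\<Prod>i=1..n. u i ^ c i))
            = (\<Sum>c\<in>exponents n. A c * (\<Prod>i=1..n. u i ^ c i / fact (c i))
                - eulerian_coeff c * (\<Prod>i=1..n. u i ^ c i / fact (c i)))"
          by (rule sum.cong[OF refl]) (simp add: prod_dividef left_diff_distrib diff_divide_distrib)
        also have "\<dots> = 0"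
          unfolding sum_subtractf using A[OF u] vol_fun_expansion[OF u] by simp
        finally show "(\<Sum>c\<in>exponents n. ?D c * (\<Prod>i=1..n. u i ^ c i)) = 0" .
      qed simp
      moreover have "(\<Prod>i=1..n. fact (c i) :: real) \<noteq> 0" by simp
      ultimately show ?thesis by simp
    qed
    then show "A = (\<lambda>c. if c \<in> exponents n then eulerian_coeff c else 0)"
      using off by auto
  next
    fix u :: "nat \<Rightarrow> real" assume u: "\<forall>i\<in>{1..n}. 0 \<le> u i"
    show "vol_fun \<Phi> n \<alpha> u = (\<Sum>c\<in>exponents n. (if c \<in> exponents n then eulerian_coeff c else 0)
        * (\<Prod>i=1..n. u i ^ c i / fact (c i)))"
      unfolding vol_fun_expansion[OF u] by (rule sum.cong) simp_all
  qed simp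
  then show ?thesis using c by simp
qed

lemma dynkin_induced_connected:
  assumes "irreducible_root_system \<Phi>"
  shows "induced_connected (dynkin_edges \<alpha> n) {1..n}"
proof -
  have sub: "dynkin_edges \<alpha> n \<subseteq> {1..n} \<times> {1..n}" by (auto simp: dynkin_edges_def)
  then have restrict: "dynkin_edges \<alpha> n \<inter> {1..n} \<times> {1..n} = dynkin_edges \<alpha> n" by blast
  have "(i, j) \<in> (dynkin_edges \<alpha> n)\<^sup>*" if i: "i \<in> {1..n}" and j: "j \<in> {1..n}" for i j
  proof -
    define I where "I = {k \<in> {1..n}. (k, j) \<in> (dynkin_edges \<alpha> n)\<^sup>*}"
    have "I = {1..n}"
    proof (rule dynkin_connected[OF assms])
      show "I \<subseteq> {1..n}" "I \<noteq> {}" using j by (auto simp: I_def)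
      fix a b assume a: "a \<in> I" and b: "b \<in> {1..n} - I"
      show "\<alpha> a \<bullet> \<alpha> b = 0"
      proof (rule ccontr)
        assume "\<alpha> a \<bullet> \<alpha> b \<noteq> 0"
        then have "(b, a) \<in> dynkin_edges \<alpha> n"
          using a b by (auto simp: dynkin_edges_def I_def inner_commute)
        then have "b \<in> I" using a b by (auto simp: I_def intro: converse_rtrancl_into_rtrancl)
        then show False using b by blast
      qed
    qed
    then have "i \<in> I" using i by simp
    then show ?thesis by (simp add: I_def)
  qed
  then show ?thesis unfolding induced_connected_def restrict by blast
qed

end

lemma count_from_monomial:
  assumes ii: "\<forall>j\<in>{1..n}. ii j \<in> {1..n}"
    and monomial: "\<forall>u :: nat \<Rightarrow> real. (\<Prod>j=1..n. u (ii j)) = (\<Prod>k=1..n. u k ^ c k)"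
    and c: "c \<in> exponents n"
  shows "count (mset (map ii [1..<Suc n])) = c"
proof
  fix k
  let ?is = "map ii [1..<Suc n]"
  have set_is: "set ?is \<subseteq> {1..n}" using ii by (auto simp del: upt_Suc)
  show "count (mset ?is) k = c k"
  proof (cases "k \<in> {1..n}")
    case True
    let ?u = "\<lambda>i. if i = k then 2 else (1::real)"
    have "(\<Prod>i=1..n. ?u i ^ count (mset ?is) i) = prod_list (map ?u ?is)"
      using prod_list_count[OF set_is] by simp
    also have "\<dots> = (\<Prod>j=1..n. ?u (ii j))"
      by (simp add: prod.distinct_set_conv_list[symmetric] comp_def
          atLeastLessThanSuc_atLeastAtMost del: upt_Suc)
    also have "\<dots> = (\<Prod>i=1..n. ?u i ^ c i)" by (rule monomial[THEN spec])
    finally have eq: "(\<Prod>i=1..n. ?u i ^ count (mset ?is) i) = (\<Prod>i=1..n. ?u i ^ c i)" .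
    have pow: "(\<Prod>i=1..n. ?u i ^ d i) = 2 ^ d k" for d :: "nat \<Rightarrow> nat"
    proof -
      have "(\<Prod>i=1..n. ?u i ^ d i) = (\<Prod>i=1..n. if i = k then 2 ^ d k else 1)"
        by (rule prod.cong) auto
      then show ?thesis using True by simp
    qed
    have "(2::real) ^ count (mset ?is) k = 2 ^ c k" using eq unfolding pow .
    then show ?thesis by (simp del: upt_Suc)
  next
    case False
    then have "k \<notin># mset ?is" using set_is by (auto simp del: upt_Suc)
    then show ?thesis using c False by (simp only: not_in_iff) (auto simp: exponents_def)
  qed
qed

theorem theorem18p5:
  fixes \<Phi> :: "'a::euclidean_space set" and \<alpha> :: "nat \<Rightarrow> 'a" and n :: nat
    and c ii :: "nat \<Rightarrow> nat"
  assumes "irreducible_root_system \<Phi>"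
    and "simple_roots \<Phi> n \<alpha>"
    and "c \<in> exponents n"
    and "\<forall>j\<in>{1..n}. ii j \<in> {1..n}"
    and "\<forall>u :: nat \<Rightarrow> real. (\<Prod>j=1..n. u (ii j)) = (\<Prod>k=1..n. u k ^ c k)"
  shows "mixed_eulerian \<Phi> n \<alpha> c =
    2 ^ n * real (card (weyl_group \<Phi>)) / (\<Prod>i=1..n. \<alpha> i \<bullet> \<alpha> i) *
    (\<Sum>(T, v) \<in> {(T, v). increasing_Phi_tree \<alpha> n T v \<and> compatible n ii T v}.
       \<Prod>j=1..n. fund_weight \<alpha> (desc j T) (ii (v j)) \<bullet> fund_weight \<alpha> (desc j T) j)"
proof -
  interpret root_basis \<Phi> n \<alpha>
    using assms(1,2) by unfold_locales (auto simp: irreducible_root_system_def)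
  let ?S = "{(T, v). increasing_Phi_tree \<alpha> n T v \<and> compatible n ii T v}"
  let ?f = "\<lambda>(T, v). \<Prod>j=1..n. fund_weight \<alpha> (desc j T) (ii (v j)) \<bullet> fund_weight \<alpha> (desc j T) j"
  let ?g = "\<lambda>v. \<Prod>j=1..n. fund_weight \<alpha> {1..n} (ii (v j)) \<bullet> dual {l \<in> {1..n}. v j \<le> v l} j"
  let ?tree = "dynkin_labelling.tree \<alpha> n"
  let ?C = "{v. v permutes {1..n} \<and> compatible n ii (?tree v) v}"
  define q where "q = (\<Prod>j=1..n. 2 / (\<alpha> j \<bullet> \<alpha> j))"
  have conn: "induced_connected (dynkin_edges \<alpha> n) {1..n}"
    by (rule dynkin_induced_connected[OF assms(1)])
  have q: "q = 2 ^ n / (\<Prod>i=1..n. \<alpha> i \<bullet> \<alpha> i)"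
    by (simp add: q_def prod_dividef)
  have S: "?S = (\<lambda>v. (?tree v, v)) ` ?C"
  proof (intro subset_antisym subsetI)
    fix s assume "s \<in> ?S"
    then obtain T v where s: "s = (T, v)" "increasing_Phi_tree \<alpha> n T v" "compatible n ii T v" by blast
    then interpret dynkin_labelling \<alpha> n v by unfold_locales (simp add: increasing_Phi_tree_def)
    show "s \<in> (\<lambda>v. (?tree v, v)) ` ?C"
      using increasing_tree_unique[OF s(2)] s permutes by blast
  next
    fix s assume "s \<in> (\<lambda>v. (?tree v, v)) ` ?C"
    then obtain v where v: "v permutes {1..n}" "compatible n ii (?tree v) v" "s = (?tree v, v)" by blast
    then interpret dynkin_labelling \<alpha> n v by unfold_locales
    show "s \<in> ?S" using tree_increasing[OF conn rank_pos] v by blast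
  qed
  have term_eq: "?g v = (if v \<in> ?C then q * ?f (?tree v, v) else 0)" if v: "v permutes {1..n}" for v
  proof -
    interpret dynkin_labelling \<alpha> n v using v by unfold_locales
    have desc: "desc j tree = component j" if "j \<in> {1..n}" for j
      using desc_eq_component[OF tree_increasing[OF conn rank_pos] that] .
    have factor: "fund_weight \<alpha> {1..n} (ii (v j)) \<bullet> dual {l \<in> {1..n}. v j \<le> v l} j
        = (if ii (v j) \<in> desc j tree then 2 / (\<alpha> j \<bullet> \<alpha> j) *
            (fund_weight \<alpha> (desc j tree) (ii (v j)) \<bullet> fund_weight \<alpha> (desc j tree) j) else 0)"
      if j: "j \<in> {1..n}" for j
    proof -
      have "dual (above j) j = dual (component j) j"
        using component_above[OF j] component_self component_closed[OF _ _ j]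
        by (intro dual_component) (auto simp: above_def)
      moreover have "ii (v j) \<in> {1..n}" using assms(4) j permutes_in_image[OF v] by blast
      moreover have "component j \<subseteq> {1..n}" using component_in[OF j] by blast
      ultimately show ?thesis
        using fund_weight_inner_dual[of "component j" j "ii (v j)"] component_self[of j]
        unfolding desc[OF j] above_def[symmetric] by simp
    qed
    show ?thesis
    proof (cases "compatible n ii tree v")
      case True
      have "?g v = (\<Prod>j=1..n. 2 / (\<alpha> j \<bullet> \<alpha> j) *
          (fund_weight \<alpha> (desc j tree) (ii (v j)) \<bullet> fund_weight \<alpha> (desc j tree) j))"
        using factor True by (intro prod.cong) (auto simp: compatible_def)
      also have "\<dots> = q * ?f (tree, v)" by (simp only: q_def prod.distrib case_prod_conv)
      finally show ?thesis using True v by simp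
    next
      case False
      then obtain j where "j \<in> {1..n}" "ii (v j) \<notin> desc j tree" by (auto simp: compatible_def)
      then have "?g v = 0" using factor by (intro prod_zero) auto
      then show ?thesis using False by simp
    qed
  qed
  have "(\<Sum>v | v permutes {1..n}. ?g v) = (\<Sum>v | v permutes {1..n}. if v \<in> ?C then q * ?f (?tree v, v) else 0)"
    by (rule sum.cong[OF refl]) (simp only: mem_Collect_eq term_eq)
  also have "\<dots> = (\<Sum>v\<in>?C. q * ?f (?tree v, v))"
    using finite_permutations[of "{1..n}"] by (intro sum.mono_neutral_cong_right) auto
  also have "\<dots> = q * (\<Sum>s\<in>?S. ?f s)"
    unfolding S sum_distrib_left by (subst sum.reindex) (auto simp: inj_on_def)
  finally have sum: "(\<Sum>v | v permutes {1..n}. ?g v) = q * (\<Sum>s\<in>?S. ?f s)" .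
  have "mixed_eulerian \<Phi> n \<alpha> c
      = real (card (weyl_group \<Phi>)) * flag_sum (fund_weight \<alpha> {1..n}) {1..n} (map ii [1..<Suc n])"
    unfolding mixed_eulerian_eq_coeff[OF assms(3)]
    using assms(4) count_from_monomial[OF assms(4,5,3)]
    by (intro eulerian_coeff_eq) (auto simp del: upt_Suc)
  also have "\<dots> = real (card (weyl_group \<Phi>)) * (q * (\<Sum>s\<in>?S. ?f s))"
    unfolding flag_sum_permutes sum ..
  finally show ?thesis by (simp add: q)
qed

end
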